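(* For every prime $p\geq 3$ and every integer $r\geq 3$, $$g_r(\mathbb{Z}_p)= \binom{r}{2}2^p-r^2+2r+ r\binom{r-1}{2}p\Big(2^{\frac{p-1}{c \cdot \mathrm{ord}_p(2)}}-2\Big),$$ where $c=1$ if $\mathrm{ord}_p(2)$ is even, and $c=2$ otherwise.
   Context: $\mathbb{Z}_p$ is the cyclic group $\{0,1,\ldots,p-1\}$ under addition modulo $p$. A 3-AP in $\mathbb{Z}_p$ is a sequence $a,b,c$ of elements of $\mathbb{Z}_p$ with $a+c\equiv 2b \pmod p$. An $r$-coloring of $\mathbb{Z}_p$ is any map $\mathbb{Z}_p\to[r]=\{1,\dots,r\}$ (not necessarily surjective); it is rainbow 3-AP-free if there is no 3-AP in $\mathbb{Z}_p$ whose three terms have pairwise distinct colors. $g_r(\mathbb{Z}_p)$ is the number of rainbow 3-AP-free $r$-colorings of $\mathbb{Z}_p$. $\mathrm{ord}_p(2)$ is the order of $2$ in the multiplicative group $\mathbb{Z}_p^\times$ of integers modulo $p$. *)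

theory Defs
  imports Complex_Main "HOL-Library.FuncSet" "HOL-Number_Theory.Number_Theory"
begin

text \<open>
  \<open>\<int>\<^sub>p\<close> is represented by the residues \<open>{0..<p}\<close>, with addition taken modulo \<open>p\<close>. The terms of a
  3-AP need not be distinct.
\<close>

definition three_AP :: "nat \<Rightarrow> nat \<Rightarrow> nat \<Rightarrow> nat \<Rightarrow> bool" where
  "three_AP p a b c \<longleftrightarrow>
     a \<in> {0..<p} \<and> b \<in> {0..<p} \<and> c \<in> {0..<p} \<and> [a + c = 2 * b] (mod p)"

definition rainbow_3AP_free :: "nat \<Rightarrow> (nat \<Rightarrow> nat) \<Rightarrow> bool" where
  "rainbow_3AP_free p f \<longleftrightarrow>
     \<not> (\<exists>a b c. three_AP p a b c \<and> f a \<noteq> f b \<and> f b \<noteq> f c \<and> f a \<noteq> f c)"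

text \<open>
  Colorings are extensional functions (\<open>undefined\<close> outside \<open>{0..<p}\<close>), so that each map
  \<open>\<int>\<^sub>p \<rightarrow> {1..r}\<close> is counted exactly once.
\<close>

definition colorings :: "nat \<Rightarrow> nat \<Rightarrow> (nat \<Rightarrow> nat) set" where
  "colorings r p = {0..<p} \<rightarrow>\<^sub>E {1..r}"

definition g :: "nat \<Rightarrow> nat \<Rightarrow> nat" where
  "g r p = card {f \<in> colorings r p. rainbow_3AP_free p f}"

end

theory Submission
  imports Defs "HOL-Library.Set_Algebras"
begin

text \<open>
  Three classes \<open>A, B, C\<close>, each with at least two elements, always contain a rainbow 3-AP. A
  combinatorial argument on \<open>\<int>\<close> shows that, for every \<open>d\<close>, the pairs \<open>(x, x + d)\<close> cannot realise all
  three combinations of two different colors. Hence the symmetrised difference sets of the three pairs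
  of classes have total size at most \<open>2 (p - 1)\<close>, so one of them, say that of \<open>A\<close> and \<open>B\<close>, has fewer
  than \<open>|A| + |B|\<close> elements. Its complement \<open>T\<close> is symmetric, contains \<open>0\<close> and is closed under doubling,
  and \<open>B + T\<close> avoids \<open>A\<close>, which forces \<open>|B + T| < |B| + |T|\<close>. Vosper's theorem, obtained through
  Hamidoune's isoperimetric method, makes \<open>T\<close> an arithmetic progression centred at \<open>0\<close>; such a
  progression is not closed under doubling.

  Consequently a rainbow-free coloring with at least three colors has a color used only once, at \<open>x\<^sub>0\<close>
  say. The 3-APs through \<open>x\<^sub>0\<close> make the coloring constant on the translates by \<open>x\<^sub>0\<close> of the cosets of
  the group generated by \<open>-1\<close> and \<open>2\<close>, and merging colors shows that exactly two further colors occur.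
\<close>

section \<open>Counting maps onto one or two colors\<close>

lemma card_onto_singleton:
  assumes "card P = 1" "A \<noteq> {}"
  shows "card {h \<in> A \<rightarrow>\<^sub>E P. h ` A = P} = 1"
proof -
  obtain a where P: "P = {a}" using assms by (auto simp: card_1_singleton_iff)
  then have "{h \<in> A \<rightarrow>\<^sub>E P. h ` A = P} = {\<lambda>x\<in>A. a}"
    using assms(2) by (auto simp: PiE_singleton)
  then show ?thesis by simp
qed

lemma card_onto_doubleton:
  assumes "finite A" "A \<noteq> {}" "card P = 2"
  shows "card {h \<in> A \<rightarrow>\<^sub>E P. h ` A = P} = 2 ^ card A - 2"
proof -
  obtain a b where P: "P = {a, b}" "a \<noteq> b" using assms by (auto simp: card_2_iff)
  let ?K = "{\<lambda>x\<in>A. a, \<lambda>x\<in>A. b}"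
  have "{h \<in> A \<rightarrow>\<^sub>E P. h ` A = P} = (A \<rightarrow>\<^sub>E P) - ?K"
  proof
    show "{h \<in> A \<rightarrow>\<^sub>E P. h ` A = P} \<subseteq> (A \<rightarrow>\<^sub>E P) - ?K" using P assms(2) by auto
    show "(A \<rightarrow>\<^sub>E P) - ?K \<subseteq> {h \<in> A \<rightarrow>\<^sub>E P. h ` A = P}"
    proof
      fix h assume h: "h \<in> (A \<rightarrow>\<^sub>E P) - ?K"
      have "c \<in> h ` A" if "c \<in> P" for c
      proof (rule ccontr)
        assume c: "c \<notin> h ` A"
        \<comment> \<open>\<open>c'\<close> is the other color of the pair; a map that misses
          \<open>c\<close> takes only this value.\<close>
        obtain c' where c': "c' \<in> P" "\<And>q. q \<in> P \<Longrightarrow> q \<noteq> c \<Longrightarrow> q = c'" using P \<open>c \<in> P\<close> by auto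
        have "h = (\<lambda>x\<in>A. c')"
        proof
          fix x show "h x = (\<lambda>x\<in>A. c') x"
            using h c c'(2)[of "h x"] by (cases "x \<in> A") (auto simp: PiE_def extensional_def)
        qed
        then show False using h c' P by auto
      qed
      then show "h \<in> {h \<in> A \<rightarrow>\<^sub>E P. h ` A = P}" using h by auto
    qed
  qed
  moreover have "?K \<subseteq> A \<rightarrow>\<^sub>E P" using P by auto
  moreover have "card ?K = 2"
  proof -
    obtain x where "x \<in> A" using assms by auto
    then have "(\<lambda>x\<in>A. a) x \<noteq> (\<lambda>x\<in>A. b) x" using P by simp
    then show ?thesis by (metis card_2_iff)
  qed
  ultimately show ?thesis
    using assms P by (simp add: card_Diff_subset card_funcsetE numeral_2_eq_2)
qed

subsection \<open>Colorings of the integers\<close>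

text \<open>Sets of residues are represented by \<open>p\<close>-periodic sets of integers, and colorings of \<open>\<int>\<^sub>p\<close> by
  \<open>p\<close>-periodic functions on the integers, so that all translations and dilations are plain integer
  arithmetic.\<close>

definition int_rainbow_free :: "(int \<Rightarrow> 'a) \<Rightarrow> bool" where
  "int_rainbow_free c \<longleftrightarrow> (\<forall>x y z. x + z = 2 * y \<longrightarrow> c x = c y \<or> c y = c z \<or> c x = c z)"

lemma int_rainbow_freeD:
  "int_rainbow_free c \<Longrightarrow> x + z = 2 * y \<Longrightarrow> c x = c y \<or> c y = c z \<or> c x = c z"
  unfolding int_rainbow_free_def by blast

lemma int_rainbow_free_affine:
  assumes "int_rainbow_free c"
  shows "int_rainbow_free (\<lambda>t. c (d * t + s))"
  unfolding int_rainbow_free_def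
proof (intro allI impI)
  fix x y z :: int
  assume "x + z = 2 * y"
  then have "(d * x + s) + (d * z + s) = 2 * (d * y + s)"
    by (simp add: algebra_simps flip: distrib_left)
  then show "c (d * x + s) = c (d * y + s) \<or> c (d * y + s) = c (d * z + s) \<or> c (d * x + s) = c (d * z + s)"
    by (rule int_rainbow_freeD[OF assms])
qed

text \<open>For odd \<open>k\<close> the midpoint of the ends \<open>0\<close> and
  \<open>k + 1\<close> lies in the block and gives a rainbow triple. For even \<open>k\<close> the
  triple \<open>-1, k/2, k + 1\<close> leaves \<open>Y\<close> or \<open>Z\<close> for
  \<open>-1\<close>, and the triple \<open>-1, 0, 1\<close> leaves \<open>X\<close> or
  \<open>Y\<close>.\<close>

lemma block_before:
  assumes rf: "int_rainbow_free c" and dist: "X \<noteq> Y" "Y \<noteq> Z" "X \<noteq> Z"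
    and "k \<ge> 1" and c0: "c 0 = X" and cY: "\<And>t. 0 < t \<Longrightarrow> t \<le> k \<Longrightarrow> c t = Y" and cZ: "c (k + 1) = Z"
  shows "c (-1) = Y"
proof -
  have "even k"
  proof (rule ccontr)
    assume "odd k"
    then obtain m where m: "k = 2 * m + 1" by (elim oddE)
    have "c (m + 1) = Y" using \<open>k \<ge> 1\<close> m by (intro cY) auto
    then show False
      using int_rainbow_freeD[OF rf, of 0 "k + 1" "m + 1"] c0 cZ dist m by auto
  qed
  then obtain m where m: "k = 2 * m" by (elim evenE)
  have "c m = Y" "c 1 = Y" using \<open>k \<ge> 1\<close> m by (auto intro!: cY)
  then show ?thesis
    using int_rainbow_freeD[OF rf, of "-1" "k + 1" m] int_rainbow_freeD[OF rf, of "-1" 1 0] c0 cZ dist m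
    by auto
qed

text \<open>Midpoints of pairs starting at \<open>0\<close> give \<open>c t = c (2 * t)\<close>. For odd \<open>L\<close> this puts color \<open>X\<close> at the
  midpoint of \<open>-1\<close> and \<open>L\<close>. For even \<open>L\<close> it forces \<open>c (-2) = Z\<close>, and comparing the doublings about
  \<open>0\<close> and \<open>-2\<close> makes the first half of the block monochromatic.\<close>

lemma no_gap_between_equals:
  assumes rf: "int_rainbow_free c" and dist: "X \<noteq> Y" "Y \<noteq> Z" "X \<noteq> Z"
    and "0 < L" and ends: "c 0 = Z" "c L = Z" "c (-1) = Y" "c 1 = Y" "c (L - 1) = X"
    and inner: "\<And>t. 0 < t \<Longrightarrow> t < L \<Longrightarrow> c t = X \<or> c t = Y"
  shows False
proof -
  have dbl: "c t = c (2 * t)" if "0 < t" "2 * t < L" for t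
    using int_rainbow_freeD[OF rf, of 0 "2 * t" t] inner[of t] inner[of "2 * t"] that ends dist by auto
  show False
  proof (cases "even L")
    case False
    then obtain m where m: "L = 2 * m + 1" by (elim oddE)
    have "m \<noteq> 0" using m ends dist by auto
    then have "c m = X" using dbl[of m] m \<open>0 < L\<close> ends by auto
    then show False
      using int_rainbow_freeD[OF rf, of "-1" L m] m ends dist by auto
  next
    case True
    then obtain m where m: "L = 2 * m" by (elim evenE)
    have "m \<noteq> 1" using m ends dist by auto
    then have "m \<ge> 2" using m \<open>0 < L\<close> by auto
    have "c (L - 2) = X"
      using int_rainbow_freeD[OF rf, of "L - 2" L "L - 1"] inner[of "L - 2"] ends dist \<open>m \<ge> 2\<close> m by auto
    then have cm: "c (m - 1) = X" using dbl[of "m - 1"] m \<open>m \<ge> 2\<close> by (auto simp: algebra_simps)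
    have c2: "c (-2) = Z"
      using int_rainbow_freeD[OF rf, of "-2" L "m - 1"] int_rainbow_freeD[OF rf, of "-2" 0 "-1"]
        cm m ends dist by auto
    have "c (1 + int n) = Y" if "1 + int n < m" for n
      using that
    proof (induction n)
      case 0
      then show ?case using ends by simp
    next
      case (Suc n)
      let ?y = "1 + int n"
      have "c ?y = c (2 * ?y + 2)"
        using int_rainbow_freeD[OF rf, of "-2" "2 * ?y + 2" ?y] inner[of ?y] inner[of "2 * ?y + 2"]
          c2 dist m Suc.prems by auto
      also have "2 * ?y + 2 = 2 * (?y + 1)" by simp
      also have "c \<dots> = c (?y + 1)" using dbl[of "?y + 1"] m Suc.prems by auto
      finally show ?case using Suc by (auto simp: algebra_simps)
    qed
    from this[of "nat (m - 2)"] cm dist \<open>m \<ge> 2\<close> show False by auto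
  qed
qed

text \<open>Let \<open>z\<close> be the last \<open>Z\<close> up to \<open>j\<close> and
  \<open>x\<close> the first \<open>X\<close> after it. Since no step from \<open>Z\<close> to
  \<open>X\<close> occurs there, a nonempty block of \<open>Y\<close> separates them, and
  \<open>block_before\<close>, read from \<open>z\<close>, puts \<open>Y\<close> before
  \<open>z\<close>. Then \<open>z\<close> and \<open>j + 1\<close> are two \<open>Z\<close> with
  only \<open>X\<close> and \<open>Y\<close> in between, as excluded by
  \<open>no_gap_between_equals\<close>.\<close>

lemma no_late_transition:
  assumes rf: "int_rainbow_free c" and dist: "X \<noteq> Y" "Y \<noteq> Z" "X \<noteq> Z"
    and ran: "\<And>t. c t \<in> {X, Y, Z}"
    and "i < j" "c i = Z" "c j = X" "c (j + 1) = Z"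
    and nt: "\<And>t. i \<le> t \<Longrightarrow> t < j \<Longrightarrow> {c t, c (t + 1)} \<noteq> {X, Z}"
  shows False
proof -
  define z where "z = Max ({i..j} \<inter> {t. c t = Z})"
  have "i \<in> {i..j} \<inter> {t. c t = Z}" using \<open>i < j\<close> \<open>c i = Z\<close> by simp
  then have z: "z \<in> ({i..j} \<inter> {t. c t = Z})"
    unfolding z_def by (intro Max_in) auto
  then have "z < j" using \<open>c j = X\<close> dist by (cases "z = j") auto
  have after_z: "c t \<noteq> Z" if "z < t" "t \<le> j" for t
    using Max_ge[of "({i..j} \<inter> {t. c t = Z})" t] that z unfolding z_def[symmetric] by fastforce
  have inner: "c t = X \<or> c t = Y" if "z < t" "t \<le> j" for t
    using after_z[OF that] ran[of t] by auto
  have cz1: "c (z + 1) = Y"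
    using nt[of z] inner[of "z + 1"] z \<open>z < j\<close> by auto
  define x where "x = Min ({z<..j} \<inter> {t. c t = X})"
  have "j \<in> {z<..j} \<inter> {t. c t = X}" using \<open>z < j\<close> \<open>c j = X\<close> by simp
  then have x: "x \<in> ({z<..j} \<inter> {t. c t = X})"
    unfolding x_def by (intro Min_in) auto
  have before_x: "c t \<noteq> X" if "z < t" "t < x" for t
    using Min_le[of "({z<..j} \<inter> {t. c t = X})" t] that x unfolding x_def[symmetric] by fastforce
  have "x \<noteq> z + 1" using cz1 x dist by auto
  define c' where "c' t = c (t + z)" for t
  have rf': "int_rainbow_free c'"
    using int_rainbow_free_affine[OF rf, of 1 z] unfolding c'_def by simp
  have "c' (-1) = Y"
  proof (rule block_before[OF rf', of Z Y X "x - z - 1"])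
    show "c' t = Y" if "0 < t" "t \<le> x - z - 1" for t
      using that x before_x[of "t + z"] inner[of "t + z"] unfolding c'_def by auto
  qed (use dist x z \<open>x \<noteq> z + 1\<close> in \<open>auto simp: c'_def\<close>)
  show False
  proof (rule no_gap_between_equals[OF rf', of X Y Z "j + 1 - z"])
    show "c' (-1) = Y" by fact
    show "c' t = X \<or> c' t = Y" if "0 < t" "t < j + 1 - z" for t
      using inner[of "t + z"] that unfolding c'_def by auto
  qed (use dist z cz1 \<open>z < j\<close> assms in \<open>auto simp: c'_def algebra_simps\<close>)
qed

text \<open>The color at \<open>j + 1\<close> already occurs in the window, at an end of the earlier
  transition \<open>t2\<close> or \<open>t1\<close>, so \<open>no_late_transition\<close> applies.
  The orientation with \<open>Z\<close> at \<open>j\<close> exchanges the roles of \<open>X\<close>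
  and \<open>Z\<close>.\<close>

lemma no_last_type:
  assumes rf: "int_rainbow_free c" and dist: "X \<noteq> Y" "Y \<noteq> Z" "X \<noteq> Z"
    and ran: "\<And>t. c t \<in> {X, Y, Z}"
    and ty: "{c j, c (j + 1)} = {X, Z}"
    and nt: "\<And>t. i \<le> t \<Longrightarrow> t < j \<Longrightarrow> {c t, c (t + 1)} \<noteq> {X, Z}"
    and t1: "i \<le> t1" "t1 < j" "{c t1, c (t1 + 1)} = {X, Y}"
    and t2: "i \<le> t2" "t2 < j" "{c t2, c (t2 + 1)} = {Y, Z}"
  shows False
proof -
  consider "c j = X" "c (j + 1) = Z" | "c j = Z" "c (j + 1) = X"
    using ty by (auto simp: doubleton_eq_iff)
  then show False
  proof cases
    case 1
    have "c t2 = Z \<or> c (t2 + 1) = Z" using t2(3) by (auto simp: doubleton_eq_iff)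
    then obtain s where s: "t2 \<le> s" "s \<le> t2 + 1" "c s = Z"
      using that[of t2] that[of "t2 + 1"] by auto
    then have "s < j" using 1 t2 dist by (cases "s = j") auto
    then show False
      using no_late_transition[OF rf dist ran, of s j] 1 s t2 nt by auto
  next
    case 2
    have "c t1 = X \<or> c (t1 + 1) = X" using t1(3) by (auto simp: doubleton_eq_iff)
    then obtain s where s: "t1 \<le> s" "s \<le> t1 + 1" "c s = X"
      using that[of t1] that[of "t1 + 1"] by auto
    then have "s < j" using 2 t1 dist by (cases "s = j") auto
    moreover have "c t \<in> {Z, Y, X}" for t using ran[of t] by auto
    ultimately show False
      using no_late_transition[OF rf, of Z Y X s j] 2 s t1 nt dist by (auto simp: insert_commute)
  qed
qed

text \<open>In a shortest window from \<open>i\<close> that shows all three types of transition, the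
  last transition is the only one of its type, which \<open>no_last_type\<close> forbids.\<close>

lemma dominant_color:
  assumes rf: "int_rainbow_free c" and dist: "X \<noteq> Y" "Y \<noteq> Z" "X \<noteq> Z"
    and ran: "\<And>t. c t \<in> {X, Y, Z}"
    and ex: "{c t1, c (t1 + 1)} = {X, Y}" "{c t2, c (t2 + 1)} = {Y, Z}" "{c t3, c (t3 + 1)} = {X, Z}"
  shows False
proof -
  define i where "i = min t1 (min t2 t3)"
  \<comment> \<open>\<open>n\<close> counts the starting points of transitions, so the pair starting
    at the last point of the window reaches one step beyond it.\<close>
  define seen where "seen S n \<longleftrightarrow> (\<exists>t. i \<le> t \<and> t < i + int n \<and> {c t, c (t + 1)} = S)" for S n
  define all where "all n \<longleftrightarrow> seen {X, Y} n \<and> seen {Y, Z} n \<and> seen {X, Z} n" for n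
  define N where "N = nat (max t1 (max t2 t3) + 1 - i)"
  have seenI: "seen S N" if "t \<in> {t1, t2, t3}" "{c t, c (t + 1)} = S" for t S
    unfolding seen_def using that by (intro exI[of _ t]) (auto simp: i_def N_def)
  have "all N"
    unfolding all_def using ex seenI by blast
  define n where "n = (LEAST n. all n)"
  have n: "all n" unfolding n_def by (rule LeastI) fact
  have "n \<noteq> 0" using n by (auto simp: all_def seen_def)
  then obtain m where m: "n = Suc m" by (cases n) auto
  have nm: "\<not> all m" by (rule not_less_Least) (use m in \<open>simp add: n_def\<close>)
  define j where "j = i + int m"
  have split: "seen S n \<longleftrightarrow> seen S m \<or> {c j, c (j + 1)} = S" for S
  proof
    assume "seen S n"
    then obtain t where t: "i \<le> t" "t < i + int n" "{c t, c (t + 1)} = S" by (auto simp: seen_def)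
    show "seen S m \<or> {c j, c (j + 1)} = S"
      using t m by (cases "t = j") (auto simp: seen_def j_def)
  next
    assume "seen S m \<or> {c j, c (j + 1)} = S"
    then show "seen S n"
    proof
      assume "seen S m"
      then show ?thesis using m by (force simp: seen_def)
    next
      assume "{c j, c (j + 1)} = S"
      then show ?thesis using m unfolding seen_def by (intro exI[of _ j]) (auto simp: j_def)
    qed
  qed
  have neq: "{X, Y} \<noteq> {Y, Z}" "{X, Y} \<noteq> {X, Z}" "{Y, Z} \<noteq> {X, Z}"
    using dist by (auto simp: doubleton_eq_iff)
  have last: False
    if h: "\<not> seen {P, R} m" "{c j, c (j + 1)} = {P, R}" "seen {P, Q} m" "seen {Q, R} m"
      "P \<noteq> Q" "Q \<noteq> R" "P \<noteq> R" "\<And>t. c t \<in> {P, Q, R}" for P Q R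
  proof -
    obtain s1 where s1: "i \<le> s1" "s1 < j" "{c s1, c (s1 + 1)} = {P, Q}"
      using h(3) unfolding seen_def j_def by blast
    obtain s2 where s2: "i \<le> s2" "s2 < j" "{c s2, c (s2 + 1)} = {Q, R}"
      using h(4) unfolding seen_def j_def by blast
    have "{c t, c (t + 1)} \<noteq> {P, R}" if "i \<le> t" "t < j" for t
      using \<open>\<not> seen {P, R} m\<close> that unfolding seen_def j_def by blast
    from no_last_type[OF rf h(5-8,2) this s1 s2] show False .
  qed
  \<comment> \<open>Some type is new at \<open>j\<close>. A single transition has one type only, so
    the other two were seen before.\<close>
  consider "\<not> seen {X, Z} m" "{c j, c (j + 1)} = {X, Z}" "seen {X, Y} m" "seen {Y, Z} m"
    | "\<not> seen {X, Y} m" "{c j, c (j + 1)} = {X, Y}" "seen {X, Z} m" "seen {Y, Z} m"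
    | "\<not> seen {Y, Z} m" "{c j, c (j + 1)} = {Y, Z}" "seen {X, Y} m" "seen {X, Z} m"
    using n nm neq unfolding all_def split by argo
  then show False
  proof cases
    case 1
    then show False using last[of X Z Y] dist ran by blast
  next
    case 2
    have "c t \<in> {X, Z, Y}" for t using ran[of t] by blast
    with 2 show False using last[of X Y Z] dist insert_commute[of Z Y] by auto
  next
    case 3
    have "c t \<in> {Y, X, Z}" for t using ran[of t] by blast
    with 3 show False using last[of Y Z X] dist insert_commute[of X Y] by auto
  qed
qed

subsection \<open>Periodic sets of integers and the Cauchy--Davenport theorem\<close>

locale odd_prime =
  fixes p :: nat
  assumes prime_p: "prime p" and p_gt_2: "2 < p"
begin

definition periodic :: "int set \<Rightarrow> bool" where
  "periodic A \<longleftrightarrow> (\<forall>x y. [x = y] (mod int p) \<longrightarrow> x \<in> A \<longrightarrow> y \<in> A)"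

text \<open>Counts the residue classes of a periodic set through their least nonnegative
  representatives.\<close>

definition pcard :: "int set \<Rightarrow> nat" where
  "pcard A = card (A \<inter> {0..<int p})"

text \<open>The translate \<open>A + s\<close>, written as a preimage so that membership unfolds to
  arithmetic.\<close>

abbreviation shift :: "int \<Rightarrow> int set \<Rightarrow> int set" where
  "shift s A \<equiv> {x. x - s \<in> A}"

lemma p_pos [simp]: "0 < p" "0 < int p"
  using p_gt_2 by auto

lemma odd_p: "odd p"
  using prime_odd_nat[OF prime_p p_gt_2] .

lemma not_dvd_2: "\<not> int p dvd 2"
  using p_gt_2 by (auto dest: zdvd_imp_le)

lemma periodicD: "periodic A \<Longrightarrow> [x = y] (mod int p) \<Longrightarrow> x \<in> A \<longleftrightarrow> y \<in> A"
  unfolding periodic_def by (meson cong_sym)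

lemma periodic_mod_iff: "periodic A \<Longrightarrow> x mod int p \<in> A \<longleftrightarrow> x \<in> A"
  by (rule periodicD) (auto simp: cong_def)

lemma periodic_Int [intro]: "periodic A \<Longrightarrow> periodic B \<Longrightarrow> periodic (A \<inter> B)"
  and periodic_Un [intro]: "periodic A \<Longrightarrow> periodic B \<Longrightarrow> periodic (A \<union> B)"
  and periodic_Compl [intro]: "periodic A \<Longrightarrow> periodic (- A)"
  unfolding periodic_def Int_iff Un_iff Compl_iff by (meson cong_sym)+

lemma periodic_vimage:
  assumes "periodic A" "\<And>x y. [x = y] (mod int p) \<Longrightarrow> [f x = f y] (mod int p)"
  shows "periodic {x. f x \<in> A}"
  using assms unfolding periodic_def by blast

lemma periodic_shift [intro]: "periodic A \<Longrightarrow> periodic (shift s A)"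
  by (erule periodic_vimage) (rule cong_diff, auto)

lemma periodic_uminus [intro]: "periodic A \<Longrightarrow> periodic {x. - x \<in> A}"
  by (erule periodic_vimage) (auto simp: cong_minus_minus_iff)

lemma periodic_plus [intro]:
  assumes "periodic A"
  shows "periodic (A + B)"
  unfolding periodic_def
proof (intro allI impI)
  fix x y
  assume xy: "[x = y] (mod int p)" and "x \<in> A + B"
  then obtain a b where ab: "x = a + b" "a \<in> A" "b \<in> B" by (auto elim: set_plus_elim)
  have "[a = y - b] (mod int p)" using cong_diff[OF xy cong_refl, of b] ab by simp
  then have "y - b \<in> A" using periodicD[OF assms] ab by blast
  then have "(y - b) + b \<in> A + B" using ab by (intro set_plus_intro)
  then show "y \<in> A + B" by simp
qed

text \<open>The condition on \<open>f\<close> makes it injective on residues, hence a permutation of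
  the finite set of residues.\<close>

lemma pcard_vimage:
  assumes A: "periodic A" and f: "\<And>x y. [x = y] (mod int p) \<longleftrightarrow> [f x = f y] (mod int p)"
  shows "pcard {x. f x \<in> A} = pcard A"
proof -
  let ?h = "\<lambda>x. f x mod int p"
  have inj: "inj_on ?h {0..<int p}"
  proof (rule inj_onI)
    fix x y assume "x \<in> {0..<int p}" "y \<in> {0..<int p}" "?h x = ?h y"
    then show "x = y" using f[of x y] by (auto simp: cong_def)
  qed
  moreover have "?h ` {0..<int p} \<subseteq> {0..<int p}" by auto
  ultimately have surj: "?h ` {0..<int p} = {0..<int p}"
    by (intro endo_inj_surj) auto
  have "bij_betw ?h ({x. f x \<in> A} \<inter> {0..<int p}) (A \<inter> {0..<int p})"
    unfolding bij_betw_def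
  proof
    show "inj_on ?h ({x. f x \<in> A} \<inter> {0..<int p})" by (rule inj_on_subset[OF inj]) auto
    show "?h ` ({x. f x \<in> A} \<inter> {0..<int p}) = A \<inter> {0..<int p}"
    proof
      show "?h ` ({x. f x \<in> A} \<inter> {0..<int p}) \<subseteq> A \<inter> {0..<int p}"
        using periodic_mod_iff[OF A] by auto
      show "A \<inter> {0..<int p} \<subseteq> ?h ` ({x. f x \<in> A} \<inter> {0..<int p})"
      proof
        fix y assume y: "y \<in> A \<inter> {0..<int p}"
        then have "y \<in> ?h ` {0..<int p}" using surj by blast
        then obtain x where x: "x \<in> {0..<int p}" "y = ?h x" by blast
        then have "f x \<in> A" using y periodic_mod_iff[OF A] by simp
        then show "y \<in> ?h ` ({x. f x \<in> A} \<inter> {0..<int p})" using x by auto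
      qed
    qed
  qed
  then show ?thesis unfolding pcard_def by (rule bij_betw_same_card)
qed

lemma pcard_shift: "periodic A \<Longrightarrow> pcard (shift s A) = pcard A"
  by (erule pcard_vimage) (simp add: cong_iff_dvd_diff)

lemma pcard_uminus: "periodic A \<Longrightarrow> pcard {x. - x \<in> A} = pcard A"
  by (erule pcard_vimage) (simp add: cong_minus_minus_iff)

lemma pcard_scale:
  assumes "periodic A" "\<not> int p dvd d"
  shows "pcard {x. d * x \<in> A} = pcard A"
proof -
  have "coprime d (int p)"
    using assms prime_p by (metis coprime_commute prime_imp_coprime prime_nat_int_transfer)
  then show ?thesis by (intro pcard_vimage assms) (simp add: cong_mult_lcancel)
qed

lemma pcard_mono: "A \<subseteq> B \<Longrightarrow> pcard A \<le> pcard B"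
  unfolding pcard_def by (rule card_mono) auto

lemma pcard_psubset: "periodic A \<Longrightarrow> periodic B \<Longrightarrow> A \<subset> B \<Longrightarrow> pcard A < pcard B"
  unfolding pcard_def
proof (rule psubset_card_mono)
  assume AB: "periodic A" "periodic B" "A \<subset> B"
  then obtain x where "x \<in> B" "x \<notin> A" by auto
  then have "x mod int p \<in> B" "x mod int p \<notin> A" using AB by (auto simp: periodic_mod_iff)
  then show "A \<inter> {0..<int p} \<subset> B \<inter> {0..<int p}" using AB by auto
qed simp

lemma pcard_Un_Int: "pcard (A \<union> B) + pcard (A \<inter> B) = pcard A + pcard B"
  unfolding pcard_def
proof -
  have "(A \<union> B) \<inter> {0..<int p} = A \<inter> {0..<int p} \<union> B \<inter> {0..<int p}"
    "A \<inter> B \<inter> {0..<int p} = (A \<inter> {0..<int p}) \<inter> (B \<inter> {0..<int p})" by auto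
  then show "card ((A \<union> B) \<inter> {0..<int p}) + card (A \<inter> B \<inter> {0..<int p}) =
      card (A \<inter> {0..<int p}) + card (B \<inter> {0..<int p})"
    by (simp only:) (rule card_Un_Int[symmetric]; simp)
qed

lemma pcard_UNIV: "pcard UNIV = p"
  by (simp add: pcard_def)

lemma pcard_empty [simp]: "pcard {} = 0"
  by (simp add: pcard_def)

lemma pcard_Compl: "pcard (- A) + pcard A = p"
  using pcard_Un_Int[of "- A" A] pcard_UNIV by (simp add: pcard_def)

lemma pcard_pos: "periodic A \<Longrightarrow> x \<in> A \<Longrightarrow> 0 < pcard A"
  using pcard_psubset[of "{}" A] by (auto simp: periodic_def pcard_def)

lemma pcard_pos_iff: "periodic A \<Longrightarrow> 0 < pcard A \<longleftrightarrow> A \<noteq> {}"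
  using pcard_pos by (metis Int_empty_left card.empty less_irrefl pcard_def ex_in_conv)

lemma pcard_ge_2D:
  assumes "2 \<le> pcard A"
  obtains x y where "x \<in> A" "y \<in> A" "\<not> [x = y] (mod int p)"
proof -
  have "2 \<le> card (A \<inter> {0..<int p})" using assms by (simp add: pcard_def)
  then obtain x y where "x \<in> A \<inter> {0..<int p}" "y \<in> A \<inter> {0..<int p}" "x \<noteq> y"
    using card_le_Suc0_iff_eq[of "A \<inter> {0..<int p}"] by fastforce
  then show thesis using that[of x y] by (simp add: cong_def)
qed

lemma pcard_ge_2I:
  assumes "periodic A" "x \<in> A" "y \<in> A" "\<not> [x = y] (mod int p)"
  shows "2 \<le> pcard A"
proof -
  have "card {x mod int p, y mod int p} \<le> pcard A"
    unfolding pcard_def using assms periodic_mod_iff by (intro card_mono) auto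
  then show ?thesis using assms by (auto simp: cong_def)
qed

text \<open>Since \<open>d\<close> is invertible modulo the prime \<open>p\<close>, repeated steps
  by \<open>d\<close> reach every residue.\<close>

lemma shift_closed_UNIV:
  assumes A: "periodic A" and "A \<noteq> {}" and "\<not> int p dvd d" and cl: "\<And>x. x \<in> A \<Longrightarrow> x + d \<in> A"
  shows "A = UNIV"
proof -
  obtain a where a: "a \<in> A" using assms by auto
  have steps: "a + int n * d \<in> A" for n
  proof (induction n)
    case (Suc n)
    then show ?case using cl[of "a + int n * d"] by (simp add: algebra_simps)
  qed (use a in simp)
  have "coprime d (int p)"
    using assms prime_p by (metis coprime_commute prime_imp_coprime prime_nat_int_transfer)
  then obtain e where e: "[d * e = 1] (mod int p)" using cong_solve_coprime_int by blast
  have "y \<in> A" for y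
  proof -
    define n where "n = nat ((e * (y - a)) mod int p)"
    have "[int n = e * (y - a)] (mod int p)" by (simp add: n_def)
    then have "[int n * d = e * (y - a) * d] (mod int p)" by (rule cong_scalar_right)
    also have "e * (y - a) * d = d * e * (y - a)" by (simp add: algebra_simps)
    also have "[\<dots> = 1 * (y - a)] (mod int p)" by (rule cong_scalar_right) fact
    finally have "[a + int n * d = a + (y - a)] (mod int p)" by (intro cong_add) auto
    then show ?thesis using periodicD[OF A] steps[of n] by auto
  qed
  then show ?thesis by auto
qed

text \<open>Induction on \<open>|B|\<close> by the Dyson transform \<open>(A \<union> (B + e), B \<inter> (A - e))\<close>.\<close>

theorem Cauchy_Davenport:
  assumes "periodic A" "periodic B" "A \<noteq> {}" "B \<noteq> {}"
  shows "min p (pcard A + pcard B - 1) \<le> pcard (A + B)"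
  using assms
proof (induction "pcard B" arbitrary: A B rule: less_induct)
  case less
  have sub: "pcard A \<le> pcard (A + B)"
  proof -
    obtain b where b: "b \<in> B" using less by auto
    have "shift b A \<subseteq> A + B"
    proof
      fix x assume "x \<in> shift b A"
      then have "(x - b) + b \<in> A + B" using b by (intro set_plus_intro) auto
      then show "x \<in> A + B" by simp
    qed
    then show ?thesis using pcard_mono pcard_shift less.prems by metis
  qed
  show ?case
  proof (cases "\<exists>e. B \<inter> {x. x + e \<in> A} \<noteq> {} \<and> B \<inter> {x. x + e \<in> A} \<noteq> B")
    case True
    then obtain e where e: "B \<inter> {x. x + e \<in> A} \<noteq> {}" "B \<inter> {x. x + e \<in> A} \<noteq> B" by blast
    define B' where "B' = B \<inter> {x. x + e \<in> A}"
    define A' where "A' = A \<union> shift e B"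
    have "periodic {x. x + e \<in> A}" using periodic_shift[OF less.prems(1), of "- e"] by simp
    then have per: "periodic A'" "periodic B'"
      unfolding A'_def B'_def using less.prems by (auto intro!: periodic_Int periodic_Un periodic_shift)
    have "pcard B' < pcard B"
      using e by (intro pcard_psubset per less.prems) (auto simp: B'_def)
    moreover have "A' \<noteq> {}" "B' \<noteq> {}" using less.prems e by (auto simp: A'_def B'_def)
    ultimately have "min p (pcard A' + pcard B' - 1) \<le> pcard (A' + B')"
      using per by (intro less.hyps)
    also have "\<dots> \<le> pcard (A + B)"
    proof (rule pcard_mono, rule subsetI)
      fix x assume "x \<in> A' + B'"
      then obtain a b where ab: "x = a + b" "a \<in> A'" "b \<in> B'" by (auto elim: set_plus_elim)
      show "x \<in> A + B"
      proof (cases "a \<in> A")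
        case True
        then show ?thesis using ab by (auto simp: B'_def intro: set_plus_intro)
      next
        case False
        then have "a - e \<in> B" "b + e \<in> A" using ab by (auto simp: A'_def B'_def)
        then have "(b + e) + (a - e) \<in> A + B" by (intro set_plus_intro)
        then show ?thesis using ab by (simp add: algebra_simps)
      qed
    qed
    also have "pcard A' + pcard B' = pcard A + pcard B"
    proof -
      have "shift e B' = A \<inter> shift e B" by (auto simp: B'_def)
      then have "pcard B' = pcard (A \<inter> shift e B)" using pcard_shift[OF per(2), of e] by simp
      then show ?thesis
        using pcard_Un_Int[of A "shift e B"] pcard_shift[OF less.prems(2), of e] by (simp add: A'_def)
    qed
    finally show ?thesis .
  next
    case False
    show ?thesis
    proof (cases "2 \<le> pcard B")
      case True
      then obtain b1 b2 where b: "b1 \<in> B" "b2 \<in> B" "\<not> [b2 = b1] (mod int p)"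
        by (metis pcard_ge_2D cong_sym)
      \<comment> \<open>No transform shrinks \<open>B\<close> to a smaller nonempty set, so every
        translate of \<open>B\<close> that meets \<open>A\<close> lies in \<open>A\<close>. Hence
        \<open>A\<close> is closed under adding the difference \<open>b2 - b1\<close>.\<close>
      have "A = UNIV"
      proof (rule shift_closed_UNIV)
        show "\<not> int p dvd b2 - b1" using b by (simp add: cong_iff_dvd_diff)
        fix a assume "a \<in> A"
        then have "b1 \<in> B \<inter> {x. x + (a - b1) \<in> A}" using b by auto
        with False have "b2 \<in> B \<inter> {x. x + (a - b1) \<in> A}" using b by blast
        then show "a + (b2 - b1) \<in> A" by (simp add: algebra_simps)
      qed (use less in auto)
      then show ?thesis using sub pcard_UNIV by simp
    next
      case False
      then show ?thesis using sub by simp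
    qed
  qed
qed

subsection \<open>Critical pairs and atoms\<close>

text \<open>\<open>critical A B\<close> says that Vosper's theorem applies to \<open>A\<close> and \<open>B\<close>; \<open>atom K H\<close> says that \<open>K\<close> is a
  2-atom of \<open>H\<close> in the sense of Hamidoune.\<close>

definition critical :: "int set \<Rightarrow> int set \<Rightarrow> bool" where
  "critical A B \<longleftrightarrow> periodic A \<and> periodic B \<and> 2 \<le> pcard A \<and> 2 \<le> pcard B \<and>
     pcard (A + B) + 2 \<le> p \<and> pcard (A + B) < pcard A + pcard B"

definition atom :: "int set \<Rightarrow> int set \<Rightarrow> bool" where
  "atom K H \<longleftrightarrow> critical K H \<and> (\<forall>K'. critical K' H \<longrightarrow> pcard K \<le> pcard K')"

lemma critical_commute: "critical A B \<Longrightarrow> critical B A"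
  by (auto simp: critical_def add.commute)

lemma critical_pcard:
  assumes "critical A B"
  shows "pcard (A + B) + 1 = pcard A + pcard B"
proof -
  have "A \<noteq> {}" "B \<noteq> {}" using assms pcard_pos_iff by (auto simp: critical_def)
  then show ?thesis
    using Cauchy_Davenport[of A B] assms by (auto simp: critical_def)
qed

text \<open>For \<open>D\<close> the negated complement of \<open>K + H\<close>, the sumset
  \<open>D + H\<close> misses \<open>- K\<close>, so it has at most \<open>p - |K|\<close> residues,
  fewer than \<open>|D| + |H|\<close>. The two size conditions trade places: the room left by
  \<open>K + H\<close> makes \<open>D\<close> large, and \<open>|K| \<ge> 2\<close> leaves room for
  \<open>D + H\<close>.\<close>

lemma critical_dual:
  assumes "critical K H"
  shows "critical {x. - x \<notin> K + H} H" "pcard {x. - x \<notin> K + H} + pcard (K + H) = p"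
proof -
  let ?D = "{x. - x \<notin> K + H}"
  have per: "periodic (K + H)" "periodic K" using assms by (auto simp: critical_def)
  have D: "?D = {x. - x \<in> - (K + H)}" by auto
  have perD: "periodic ?D"
    unfolding D by (intro periodic_uminus periodic_Compl per)
  have "pcard ?D = pcard (- (K + H))"
    unfolding D by (intro pcard_uminus periodic_Compl per)
  then show *: "pcard ?D + pcard (K + H) = p" using pcard_Compl[of "K + H"] by simp
  have "?D + H \<subseteq> {x. - x \<in> - K}"
  proof
    fix x assume "x \<in> ?D + H"
    then obtain d h where "x = d + h" "d \<in> ?D" "h \<in> H" by (rule set_plus_elim)
    then have x: "x = d + h" "- d \<notin> K + H" "h \<in> H" by auto
    have "- x \<notin> K"
    proof
      assume "- x \<in> K"
      then have "- x + h \<in> K + H" using x by (intro set_plus_intro)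
      then show False using x by simp
    qed
    then show "x \<in> {x. - x \<in> - K}" by simp
  qed
  then have "pcard (?D + H) \<le> pcard (- K)"
    using pcard_mono pcard_uminus[OF periodic_Compl[OF per(2)]] by metis
  then show "critical ?D H"
    using assms * perD pcard_Compl[of K] unfolding critical_def by auto
qed

lemma atom_exists:
  assumes "critical K H"
  obtains K' where "atom K' H"
proof -
  have "\<exists>K'. critical K' H \<and> (\<forall>L. critical L H \<longrightarrow> pcard K' \<le> pcard L)"
    using assms by (rule ex_has_least_nat)
  then show thesis using that by (auto simp: atom_def)
qed

text \<open>Submodularity: if \<open>K\<close> met a translate in two points, the intersection would be critical as well,
  contradicting minimality. The dual pair gives \<open>2 |K| + |H| \<le> p + 1\<close>, which lets Cauchy--Davenport
  bound the sumset of the union.\<close>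

lemma atom_Int_shift:
  assumes K: "atom K H" and s: "\<not> int p dvd s"
  shows "pcard (K \<inter> shift s K) \<le> 1"
proof (rule ccontr)
  assume *: "\<not> ?thesis"
  have crit: "critical K H" and minimal: "\<And>K'. critical K' H \<Longrightarrow> pcard K \<le> pcard K'"
    using K by (auto simp: atom_def)
  have per: "periodic K" "periodic H" and ge2: "2 \<le> pcard K" "2 \<le> pcard H"
    using crit by (auto simp: critical_def)
  define I where "I = K \<inter> shift s K"
  define U where "U = K \<union> shift s K"
  have perIU: "periodic I" "periodic U" using per by (auto simp: I_def U_def)
  have shK: "pcard (shift s K) = pcard K" using per by (simp add: pcard_shift)
  have UI: "pcard U + pcard I = 2 * pcard K"
    using pcard_Un_Int[of K "shift s K"] shK by (simp add: U_def I_def)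
  \<comment> \<open>Otherwise \<open>K\<close> is invariant under a nonzero translation, so
    \<open>K\<close> and \<open>K + H\<close> are everything.\<close>
  have neI: "I \<noteq> K"
  proof
    assume "I = K"
    then have K': "K \<subseteq> shift s K" by (auto simp: I_def)
    have "K = UNIV"
    proof (rule shift_closed_UNIV[of _ "- s"])
      show "x + - s \<in> K" if "x \<in> K" for x using K' that by auto
    qed (use per s ge2 pcard_pos_iff in auto)
    obtain h where "h \<in> H" using ge2 by fastforce
    then have "(x - h) + h \<in> K + H" for x using \<open>K = UNIV\<close> by (intro set_plus_intro) auto
    then have "K + H = UNIV" by auto
    then show False using crit pcard_UNIV by (simp add: critical_def)
  qed
  then have "pcard I < pcard K" using per perIU by (intro pcard_psubset) (auto simp: I_def)
  have KH: "pcard (K + H) + 1 = pcard K + pcard H" using critical_pcard[OF crit] .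
  have "pcard K + pcard (K + H) \<le> p"
    using minimal[OF critical_dual(1)[OF crit]] critical_dual(2)[OF crit] by simp
  then have "pcard U + pcard H - 1 < p" using UI KH * ge2 by (simp add: I_def)
  moreover have "U \<noteq> {}" "H \<noteq> {}"
    using ge2 pcard_pos_iff per by (auto simp: U_def)
  ultimately have UH: "pcard U + pcard H - 1 \<le> pcard (U + H)"
    using Cauchy_Davenport[OF perIU(2) per(2)] by simp
  have U_eq: "U + H = (K + H) \<union> shift s (K + H)"
  proof
    show "U + H \<subseteq> (K + H) \<union> shift s (K + H)"
    proof
      fix x assume "x \<in> U + H"
      then obtain u h where x: "x = u + h" "u \<in> U" "h \<in> H" by (rule set_plus_elim)
      then have "u \<in> K \<or> u - s \<in> K" by (auto simp: U_def)
      then have "u + h \<in> K + H \<or> (u - s) + h \<in> K + H" using x by (auto intro: set_plus_intro)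
      then show "x \<in> (K + H) \<union> shift s (K + H)" using x by (auto simp: algebra_simps)
    qed
    show "(K + H) \<union> shift s (K + H) \<subseteq> U + H"
    proof
      fix x assume "x \<in> (K + H) \<union> shift s (K + H)"
      then consider "x \<in> K + H" | "x - s \<in> K + H" by auto
      then show "x \<in> U + H"
      proof cases
        case 1
        moreover have "K + H \<subseteq> U + H" by (rule set_plus_mono2) (auto simp: U_def)
        ultimately show ?thesis by blast
      next
        case 2
        then obtain k h where kh: "x - s = k + h" "k \<in> K" "h \<in> H" by (rule set_plus_elim)
        then have "(k + s) + h \<in> U + H" by (intro set_plus_intro) (auto simp: U_def)
        then show ?thesis using kh by (simp add: algebra_simps)
      qed
    qed
  qed
  have I_sub: "I + H \<subseteq> (K + H) \<inter> shift s (K + H)"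
  proof
    fix x assume "x \<in> I + H"
    then obtain u h where "x = u + h" "u \<in> I" "h \<in> H" by (rule set_plus_elim)
    then have x: "x = u + h" "u \<in> K" "u - s \<in> K" "h \<in> H" by (auto simp: I_def)
    then have "u + h \<in> K + H" "(u - s) + h \<in> K + H" by (auto intro: set_plus_intro)
    then show "x \<in> (K + H) \<inter> shift s (K + H)" using x by (auto simp: algebra_simps)
  qed
  have "periodic (K + H)" using per by auto
  then have "pcard (U + H) + pcard (I + H) \<le> 2 * pcard (K + H)"
    using pcard_Un_Int[of "K + H" "shift s (K + H)"] pcard_shift[of "K + H" s] pcard_mono[OF I_sub] U_eq
    by simp
  moreover have "pcard (I + H) \<le> pcard (K + H)"
    using I_sub by (intro pcard_mono) auto
  \<comment> \<open>With \<open>|U| + |I| = 2 |K|\<close>, submodularity and the lower bound on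
    \<open>|U + H|\<close> leave \<open>|I + H| \<le> |I| + |H| - 1\<close>.\<close>
  ultimately have "critical I H"
    using UH UI KH * crit perIU ge2 unfolding critical_def I_def[symmetric] by auto
  then show False using minimal \<open>pcard I < pcard K\<close> by fastforce
qed

lemma shift_subset_plus: "x \<in> X \<Longrightarrow> shift x Y \<subseteq> X + Y"
proof
  fix y assume "x \<in> X" "y \<in> shift x Y"
  then have "x + (y - x) \<in> X + Y" by (intro set_plus_intro) auto
  then show "y \<in> X + Y" by simp
qed

text \<open>For two residues \<open>x\<close>, \<open>y\<close> of \<open>Y\<close>, the sumset
  \<open>Y + X\<close> contains the translates of \<open>X\<close> by both, and it has at most
  \<open>|X| + 1\<close> residues. The difference \<open>y - x\<close> serves as
  \<open>d\<close>.\<close>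

lemma critical_pair_boundary:
  assumes crit: "critical Y X" and Y2: "pcard Y = 2"
  obtains d where "\<not> int p dvd d" "pcard (X \<union> shift d X) \<le> pcard X + 1"
proof -
  obtain x y where xy: "x \<in> Y" "y \<in> Y" "\<not> [x = y] (mod int p)"
    using pcard_ge_2D[of Y] Y2 by auto
  have per: "periodic X" using crit by (simp add: critical_def)
  have "shift x (X \<union> shift (y - x) X) = shift x X \<union> shift y X" by auto
  also have "\<dots> \<subseteq> Y + X" using xy shift_subset_plus by auto
  finally have "pcard (X \<union> shift (y - x) X) \<le> pcard (Y + X)"
    using pcard_mono pcard_shift[of "X \<union> shift (y - x) X" x] per by (metis periodic_Un periodic_shift)
  moreover have "\<not> int p dvd y - x" using xy by (metis cong_iff_dvd_diff cong_sym)
  ultimately show thesis using that crit Y2 by (auto simp: critical_def)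
qed

text \<open>\<open>X + Y\<close> contains three translates of \<open>Y\<close>; each of the three
  pairs overlaps in at most one residue, so the overlaps cost at most 3.\<close>

lemma three_translates:
  assumes per: "periodic Y" and sidon: "\<And>s. \<not> int p dvd s \<Longrightarrow> pcard (Y \<inter> shift s Y) \<le> 1"
    and "3 \<le> pcard X"
  shows "3 * pcard Y \<le> pcard (X + Y) + 3"
proof -
  obtain S where S: "S \<subseteq> X \<inter> {0..<int p}" "card S = 3"
    using \<open>3 \<le> pcard X\<close> obtain_subset_with_card_n unfolding pcard_def by metis
  then obtain x y z where xyz: "S = {x, y, z}" "x \<noteq> y" "x \<noteq> z" "y \<noteq> z" by (auto simp: card_3_iff)
  have Int: "pcard (shift a Y \<inter> shift b Y) \<le> 1" if "a \<in> S" "b \<in> S" "a \<noteq> b" for a b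
  proof -
    have "\<not> [b = a] (mod int p)" using that S by (auto simp: cong_def subset_iff)
    then have "\<not> int p dvd b - a" by (simp add: cong_iff_dvd_diff)
    then have "pcard (Y \<inter> shift (b - a) Y) \<le> 1" by (rule sidon)
    moreover have eq: "shift a Y \<inter> shift b Y = shift a (Y \<inter> shift (b - a) Y)" by auto
    have "pcard (shift a Y \<inter> shift b Y) = pcard (Y \<inter> shift (b - a) Y)"
      unfolding eq using per by (intro pcard_shift periodic_Int periodic_shift)
    ultimately show ?thesis by simp
  qed
  have Y: "pcard (shift a Y) = pcard Y" for a using per by (simp add: pcard_shift)
  have 1: "2 * pcard Y \<le> pcard (shift x Y \<union> shift y Y) + 1"
    using pcard_Un_Int[of "shift x Y" "shift y Y"] Int[of x y] xyz Y by auto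
  have "(shift x Y \<union> shift y Y) \<inter> shift z Y = (shift x Y \<inter> shift z Y) \<union> (shift y Y \<inter> shift z Y)" by auto
  then have 2: "pcard ((shift x Y \<union> shift y Y) \<inter> shift z Y) \<le> 2"
    using pcard_Un_Int[of "shift x Y \<inter> shift z Y" "shift y Y \<inter> shift z Y"] Int[of x z] Int[of y z] xyz
    by auto
  have "shift x Y \<union> shift y Y \<union> shift z Y \<subseteq> X + Y"
    using shift_subset_plus[of _ X Y] S xyz by blast
  then have "pcard (shift x Y \<union> shift y Y \<union> shift z Y) \<le> pcard (X + Y)" by (rule pcard_mono)
  then show ?thesis using 1 2 pcard_Un_Int[of "shift x Y \<union> shift y Y" "shift z Y"] Y by auto
qed

text \<open>The conclusion says that \<open>H\<close> is an arithmetic progression with difference \<open>d\<close>. A 2-atom \<open>X\<close> of \<open>H\<close>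
  has exactly two elements: otherwise a 2-atom \<open>Y\<close> of \<open>X\<close> is also large, and since distinct
  translates of \<open>X\<close> (and of \<open>Y\<close>) share at most one point, three translates already overfill \<open>X + Y\<close>.\<close>

theorem critical_boundary:
  assumes "critical K H"
  obtains d where "\<not> int p dvd d" "pcard (H \<union> shift d H) \<le> pcard H + 1"
proof -
  obtain X where X: "atom X H" using atom_exists[OF assms] .
  then have cX: "critical X H" by (simp add: atom_def)
  obtain Y where Y: "atom Y X" using atom_exists[OF critical_commute[OF cX]] .
  then have cY: "critical Y X" by (simp add: atom_def)
  have "pcard X = 2"
  proof (rule ccontr)
    assume "pcard X \<noteq> 2"
    then have X3: "3 \<le> pcard X" using cX by (auto simp: critical_def)
    have "pcard Y \<noteq> 2"
    proof
      assume "pcard Y = 2"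
      then obtain d where d: "\<not> int p dvd d" "pcard (X \<union> shift d X) \<le> pcard X + 1"
        using critical_pair_boundary[OF cY] by blast
      \<comment> \<open>Here \<open>X\<close> and its translate by \<open>d\<close> would share at
        least \<open>|X| - 1 \<ge> 2\<close> residues.\<close>
      then show False
        using atom_Int_shift[OF X d(1)] pcard_Un_Int[of X "shift d X"] pcard_shift[of X d] cX X3
        by (auto simp: critical_def)
    qed
    then have Y3: "3 \<le> pcard Y" using cY by (auto simp: critical_def)
    have per: "periodic X" "periodic Y" using cX cY by (auto simp: critical_def)
    \<comment> \<open>Adding both bounds from \<open>three_translates\<close> to
      \<open>|X + Y| = |X| + |Y| - 1\<close> gives \<open>|X| + |Y| \<le> 4\<close>, but both sets
      have at least 3 residues.\<close>
    show False
      using three_translates[OF per(1) atom_Int_shift[OF X] Y3]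
        three_translates[OF per(2) atom_Int_shift[OF Y] X3] critical_pcard[OF cY] X3 Y3
      by (auto simp: add.commute)
  qed
  then show thesis using critical_pair_boundary[OF cX] that by blast
qed

section \<open>Symmetric progressions are not closed under doubling\<close>

text \<open>The bound \<open>bd\<close> allows only one right end, so by symmetry \<open>T\<close>
  consists of the residues from \<open>-m\<close> to \<open>m\<close>. Then
  \<open>m div 2 + 1\<close> lies in \<open>T\<close>, while its double is \<open>m + 1\<close> or
  \<open>m + 2\<close> and falls into the gap between \<open>m\<close> and
  \<open>p - m\<close>.\<close>

lemma no_doubling_interval:
  assumes per: "periodic T" and T0: "0 \<in> T" and sym: "\<And>x. x \<in> T \<Longrightarrow> - x \<in> T"
    and dbl: "\<And>x. x \<in> T \<Longrightarrow> 2 * x \<in> T" and T2: "2 \<le> pcard T" and Tp: "pcard T < p"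
    and bd: "pcard (T \<union> shift 1 T) \<le> pcard T + 1"
  shows False
proof -
  have uniq: "[x = y] (mod int p)" if "x \<in> T" "x + 1 \<notin> T" "y \<in> T" "y + 1 \<notin> T" for x y
  proof (rule ccontr)
    assume "\<not> [x = y] (mod int p)"
    then have n: "\<not> [x + 1 = y + 1] (mod int p)" by (simp add: cong_iff_dvd_diff)
    have "2 \<le> pcard (shift 1 T \<inter> - T)"
      by (rule pcard_ge_2I[OF _ _ _ n]) (use that per in auto)
    moreover have "T \<union> shift 1 T = T \<union> (shift 1 T \<inter> - T)" by auto
    moreover have "T \<inter> (shift 1 T \<inter> - T) = {}" by auto
    ultimately show False
      using bd pcard_Un_Int[of T "shift 1 T \<inter> - T"] by (simp add: pcard_def)
  qed
  have ex: "\<exists>n. int n + 1 \<notin> T"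
  proof (rule ccontr)
    assume a: "\<not> ?thesis"
    have "int n \<in> T" for n using a T0 by (cases n) (auto simp: add.commute)
    then have "x \<in> T" if "0 \<le> x" for x using that by (metis nonneg_int_cases)
    then have "{0..<int p} \<subseteq> T" by auto
    then show False using Tp by (simp add: pcard_def Int_absorb1)
  qed
  define m where "m = (LEAST n. int n + 1 \<notin> T)"
  have m1: "int m + 1 \<notin> T" unfolding m_def by (rule LeastI_ex) (rule ex)
  have low: "int n \<in> T" if "n \<le> m" for n
  proof (cases n)
    case (Suc k)
    then have "k < m" using that by simp
    then show ?thesis using not_less_Least[of k "\<lambda>n. int n + 1 \<notin> T"] Suc by (auto simp: m_def add.commute)
  qed (use T0 in simp)
  \<comment> \<open>If \<open>T\<close> were entered again at \<open>j + 1\<close>, symmetry would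
    make \<open>-(j + 1)\<close> a right end. By \<open>uniq\<close> it is congruent to
    \<open>m\<close>, so \<open>p\<close> divides \<open>m + j + 1\<close>, which is too
    small.\<close>
  have high: "int n \<notin> T" if "m < n" "n + m < p" for n
    using that
  proof (induction n)
    case (Suc j)
    show ?case
    proof (cases "j = m")
      case True
      then show ?thesis using m1 by (simp add: add.commute)
    next
      case False
      then have j: "int j \<notin> T" using Suc by auto
      show ?thesis
      proof
        assume "int (Suc j) \<in> T"
        then have "- int (Suc j) \<in> T" "- int (Suc j) + 1 \<notin> T"
          using sym[of "int (Suc j)"] sym[of "- int j"] j by auto
        then have "[int m = - int (Suc j)] (mod int p)"
          using uniq[of "int m" "- int (Suc j)"] low[of m] m1 by auto
        then have "int p dvd int (m + Suc j)" by (simp add: cong_iff_dvd_diff algebra_simps)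
        then have "p dvd m + Suc j" by (simp only: int_dvd_int_iff)
        then show False using Suc.prems by (auto dest: dvd_imp_le)
      qed
    qed
  qed simp
  have "2 * m + 1 < p"
  proof (rule ccontr)
    assume a: "\<not> ?thesis"
    have "x \<in> T" if "x \<in> {0..<int p}" for x
    proof (cases "x \<le> int m")
      case True
      then show ?thesis using low[of "nat x"] that by auto
    next
      case False
      then have "int p - x \<in> T" using low[of "nat (int p - x)"] that a by auto
      then have "x - int p \<in> T" using sym[of "int p - x"] by simp
      then show ?thesis using periodicD[OF per, of x "x - int p"] by (simp add: cong_iff_dvd_diff)
    qed
    then have "{0..<int p} \<subseteq> T" by auto
    then show False using Tp by (simp add: pcard_def Int_absorb1)
  qed
  \<comment> \<open>Parity of \<open>p\<close> improves the bound by one, which makes room for the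
    double \<open>m + 2\<close>.\<close>
  then have mp: "2 * m + 2 < p" using odd_p by (cases "2 * m + 2 = p") auto
  have "m \<noteq> 0"
  proof
    assume m0: "m = 0"
    have "T \<inter> {0..<int p} \<subseteq> {0}"
    proof
      fix x assume x: "x \<in> T \<inter> {0..<int p}"
      then show "x \<in> {0}" using high[of "nat x"] m0 by (cases "x = 0") (auto simp: nat_less_iff)
    qed
    then have "pcard T \<le> card {0::int}" unfolding pcard_def by (intro card_mono) auto
    then show False using T2 by simp
  qed
  then have "int (m div 2 + 1) \<in> T" by (intro low) auto
  then have "int (2 * (m div 2 + 1)) \<in> T" using dbl by fastforce
  moreover have "int (2 * (m div 2 + 1)) \<notin> T" using mp by (intro high) presburger+
  ultimately show False by blast
qed

text \<open>Dividing by \<open>d\<close> modulo \<open>p\<close> turns the difference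
  \<open>d\<close> into 1 and preserves sizes, symmetry and closure under doubling.\<close>

lemma no_doubling_progression:
  assumes per: "periodic T" and T0: "0 \<in> T" and sym: "\<And>x. x \<in> T \<Longrightarrow> - x \<in> T"
    and dbl: "\<And>x. x \<in> T \<Longrightarrow> 2 * x \<in> T" and T2: "2 \<le> pcard T" and Tp: "pcard T < p"
    and d: "\<not> int p dvd d" and bd: "pcard (T \<union> shift d T) \<le> pcard T + 1"
  shows False
proof (rule no_doubling_interval[of "{x. d * x \<in> T}"])
  show "periodic {x. d * x \<in> T}" using per by (rule periodic_vimage) (rule cong_scalar_left)
  show "- x \<in> {x. d * x \<in> T}" "2 * x \<in> {x. d * x \<in> T}" if "x \<in> {x. d * x \<in> T}" for x
    using that sym[of "d * x"] dbl[of "d * x"] by (auto simp: algebra_simps)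
  have eq: "{x. d * x \<in> T} \<union> shift 1 {x. d * x \<in> T} = {x. d * x \<in> T \<union> shift d T}"
    by (auto simp: algebra_simps)
  show "pcard ({x. d * x \<in> T} \<union> shift 1 {x. d * x \<in> T}) \<le> pcard {x. d * x \<in> T} + 1"
    unfolding eq pcard_scale[OF periodic_Un[OF per periodic_shift[OF per]] d] pcard_scale[OF per d]
    by (rule bd)
qed (use T0 T2 Tp pcard_scale[OF per d] in auto)

subsection \<open>Three large color classes\<close>

text \<open>The complement of \<open>diffs F P Q\<close> is closed under doubling: the midpoint of a pair with colors
  \<open>P\<close> and \<open>Q\<close> has one of these two colors.\<close>

definition diffs :: "(int \<Rightarrow> 'a) \<Rightarrow> 'a \<Rightarrow> 'a \<Rightarrow> int set" where
  "diffs F P Q = {d. \<exists>x. {F x, F (x + d)} = {P, Q}}"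

definition periodic_fun :: "(int \<Rightarrow> 'a) \<Rightarrow> bool" where
  "periodic_fun F \<longleftrightarrow> (\<forall>x y. [x = y] (mod int p) \<longrightarrow> F x = F y)"

lemma periodic_funD: "periodic_fun F \<Longrightarrow> [x = y] (mod int p) \<Longrightarrow> F x = F y"
  by (auto simp: periodic_fun_def)

lemma periodic_color_class: "periodic_fun F \<Longrightarrow> periodic {x. F x = Q}"
  unfolding periodic_def periodic_fun_def by auto

lemma periodic_diffs:
  assumes F: "periodic_fun F"
  shows "periodic (diffs F P Q)"
  unfolding periodic_def
proof (intro allI impI)
  fix d e
  assume de: "[d = e] (mod int p)" and "d \<in> diffs F P Q"
  then obtain x where "{F x, F (x + d)} = {P, Q}" by (auto simp: diffs_def)
  moreover have "F (x + d) = F (x + e)" using de by (intro periodic_funD[OF F] cong_add) auto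
  ultimately show "e \<in> diffs F P Q" by (auto simp: diffs_def)
qed

lemma diffs_not_dvd:
  assumes F: "periodic_fun F" and "P \<noteq> Q" and d: "d \<in> diffs F P Q"
  shows "\<not> int p dvd d"
proof
  assume "int p dvd d"
  then have "[x + d = x] (mod int p)" for x by (simp add: cong_iff_dvd_diff)
  then have "F (x + d) = F x" for x using periodic_funD[OF F] by blast
  then show False using d \<open>P \<noteq> Q\<close> by (auto simp: diffs_def)
qed

lemma uminus_diffs:
  assumes "d \<in> diffs F P Q"
  shows "- d \<in> diffs F P Q"
proof -
  obtain x where "{F x, F (x + d)} = {P, Q}" using assms by (auto simp: diffs_def)
  then have "{F (x + d), F ((x + d) + - d)} = {P, Q}" by (simp add: insert_commute)
  then show ?thesis unfolding diffs_def by blast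
qed

lemma half_diffs:
  assumes rf: "int_rainbow_free F" and "2 * d \<in> diffs F P Q" and "P \<noteq> Q"
  shows "d \<in> diffs F P Q"
proof -
  obtain x where x: "{F x, F (x + 2 * d)} = {P, Q}" using assms by (auto simp: diffs_def)
  then have "F (x + d) \<in> {P, Q}"
    using int_rainbow_freeD[OF rf, of x "x + 2 * d" "x + d"] \<open>P \<noteq> Q\<close> by (auto simp: doubleton_eq_iff)
  then have "{F x, F (x + d)} = {P, Q} \<or> {F (x + d), F ((x + d) + d)} = {P, Q}"
    using x by (auto simp: doubleton_eq_iff algebra_simps)
  then show ?thesis unfolding diffs_def by blast
qed

text \<open>Along the coloring \<open>t \<mapsto> F (d * t)\<close> a pair at distance
  \<open>d\<close> becomes a pair of neighbours, found at \<open>e * x\<close> with \<open>e\<close>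
  the inverse of \<open>d\<close>. A common difference would thus produce all three types of
  transition.\<close>

lemma diffs_no_common:
  assumes F: "periodic_fun F" and rf: "int_rainbow_free F" and dist: "X \<noteq> Y" "Y \<noteq> Z" "X \<noteq> Z"
    and ran: "\<And>t. F t \<in> {X, Y, Z}"
  shows "diffs F X Y \<inter> diffs F Y Z \<inter> diffs F X Z = {}"
proof (rule ccontr)
  assume "\<not> ?thesis"
  then obtain d where d: "d \<in> diffs F X Y" "d \<in> diffs F Y Z" "d \<in> diffs F X Z" by blast
  have "\<not> int p dvd d" using diffs_not_dvd[OF F dist(1) d(1)] .
  then have "coprime d (int p)"
    using prime_p by (metis coprime_commute prime_imp_coprime prime_nat_int_transfer)
  then obtain e where e: "[d * e = 1] (mod int p)" using cong_solve_coprime_int by blast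
  have adj: "\<exists>t. {F (d * t), F (d * (t + 1))} = {P, Q}" if PQ: "d \<in> diffs F P Q" for P Q
  proof -
    obtain x where x: "{F x, F (x + d)} = {P, Q}" using PQ by (auto simp: diffs_def)
    have "[d * e * x = 1 * x] (mod int p)" by (rule cong_scalar_right) fact
    then have ex: "[d * (e * x) = x] (mod int p)" by (simp add: mult.assoc)
    then have "[d * (e * x + 1) = x + d] (mod int p)"
      using cong_add[OF ex cong_refl, of d] by (simp add: algebra_simps)
    then have "{F (d * (e * x)), F (d * (e * x + 1))} = {P, Q}"
      using x periodic_funD[OF F] ex by metis
    then show ?thesis by blast
  qed
  obtain t1 t2 t3 where "{F (d * t1), F (d * (t1 + 1))} = {X, Y}"
    "{F (d * t2), F (d * (t2 + 1))} = {Y, Z}" "{F (d * t3), F (d * (t3 + 1))} = {X, Z}"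
    using adj d by metis
  moreover have "int_rainbow_free (\<lambda>t. F (d * t))"
    using int_rainbow_free_affine[OF rf, of d 0] by simp
  ultimately show False
    using dominant_color[of "\<lambda>t. F (d * t)" X Y Z t1 t2 t3] dist ran by blast
qed

text \<open>If the bound fails, the complement \<open>T\<close> has more than \<open>|R|\<close>
  residues, writing colors for their classes. As \<open>Q + T\<close> misses \<open>P\<close>, it
  has at most \<open>p - |P| < |Q| + |T|\<close> residues, so the pair is critical and
  \<open>T\<close> is a progression.\<close>

lemma pcard_diffs_lower:
  assumes F: "periodic_fun F" and rf: "int_rainbow_free F" and dist: "P \<noteq> Q" "Q \<noteq> R" "P \<noteq> R"
    and ran: "\<And>t. F t \<in> {P, Q, R}"
    and ge2: "2 \<le> pcard {x. F x = P}" "2 \<le> pcard {x. F x = Q}" "2 \<le> pcard {x. F x = R}"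
  shows "pcard {x. F x = P} + pcard {x. F x = Q} \<le> pcard (diffs F P Q)"
proof (rule ccontr)
  assume less: "\<not> ?thesis"
  let ?C = "\<lambda>Q. {x. F x = Q}"
  define T where "T = - diffs F P Q"
  have perT: "periodic T" unfolding T_def using periodic_diffs[OF F] by blast
  have total: "pcard (?C P) + pcard (?C Q) + pcard (?C R) = p"
  proof -
    have "?C P \<union> ?C Q \<union> ?C R = UNIV" using ran by auto
    moreover have "?C P \<inter> ?C Q = {}" "(?C P \<union> ?C Q) \<inter> ?C R = {}" using dist by auto
    ultimately show ?thesis
      using pcard_Un_Int[of "?C P" "?C Q"] pcard_Un_Int[of "?C P \<union> ?C Q" "?C R"] pcard_UNIV by simp
  qed
  have T: "pcard T + pcard (diffs F P Q) = p" unfolding T_def by (rule pcard_Compl)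
  obtain x where "F x = P" using ge2(1) by fastforce
  obtain y where "F y = Q" using ge2(2) by fastforce
  have "{F x, F (x + (y - x))} = {P, Q}" using \<open>F x = P\<close> \<open>F y = Q\<close> by simp
  then have "y - x \<in> diffs F P Q" unfolding diffs_def by blast
  then have pos: "0 < pcard (diffs F P Q)" using pcard_pos periodic_diffs[OF F] by blast
  have "?C Q + T \<subseteq> - ?C P"
  proof
    fix x assume "x \<in> ?C Q + T"
    then obtain b t where bt: "x = b + t" "b \<in> ?C Q" "t \<in> T" by (rule set_plus_elim)
    show "x \<in> - ?C P"
    proof
      assume "x \<in> ?C P"
      then have "{F b, F (b + t)} = {P, Q}" using bt by auto
      then show False using bt by (auto simp: T_def diffs_def)
    qed
  qed
  then have "pcard (?C Q + T) \<le> pcard (- ?C P)" by (rule pcard_mono)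
  then have "critical (?C Q) T"
    unfolding critical_def
    using periodic_color_class[OF F, of Q] perT ge2 less T total pcard_Compl[of "?C P"] by auto
  then obtain d where d: "\<not> int p dvd d" "pcard (T \<union> shift d T) \<le> pcard T + 1"
    by (rule critical_boundary)
  show False
  proof (rule no_doubling_progression[OF perT _ _ _ _ _ d])
    show "0 \<in> T" using diffs_not_dvd[OF F dist(1), of 0] by (auto simp: T_def)
    show "- x \<in> T" if "x \<in> T" for x using that uminus_diffs[of "- x" F P Q] by (auto simp: T_def)
    show "2 * x \<in> T" if "x \<in> T" for x using that half_diffs[OF rf _ dist(1), of x] by (auto simp: T_def)
  qed (use T total ge2 less pos in auto)
qed

text \<open>The three difference sets lie in the \<open>p - 1\<close> nonzero residues and have no
  common element, so their sizes add up to at most \<open>2 (p - 1)\<close>. The lower bounds add up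
  to \<open>2 p\<close>.\<close>

theorem rainbow_free_small_class:
  assumes F: "periodic_fun F" and rf: "int_rainbow_free F" and dist: "X \<noteq> Y" "Y \<noteq> Z" "X \<noteq> Z"
    and ran: "\<And>t. F t \<in> {X, Y, Z}"
    and ge2: "2 \<le> pcard {x. F x = X}" "2 \<le> pcard {x. F x = Y}" "2 \<le> pcard {x. F x = Z}"
  shows False
proof -
  let ?C = "\<lambda>Q. {x. F x = Q}"
  let ?U = "{x. \<not> int p dvd x}"
  have "?C X \<union> ?C Y \<union> ?C Z = UNIV" using ran by auto
  moreover have "?C X \<inter> ?C Y = {}" "(?C X \<union> ?C Y) \<inter> ?C Z = {}" using dist by auto
  ultimately have total: "pcard (?C X) + pcard (?C Y) + pcard (?C Z) = p"
    using pcard_Un_Int[of "?C X" "?C Y"] pcard_Un_Int[of "?C X \<union> ?C Y" "?C Z"] pcard_UNIV by simp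
  have "?U \<inter> {0..<int p} = {0<..<int p}" by (auto simp: zdvd_not_zless intro: le_neq_trans)
  then have U: "pcard ?U = p - 1" by (simp add: pcard_def)
  have sub: "diffs F X Y \<subseteq> ?U" "diffs F Y Z \<subseteq> ?U" "diffs F X Z \<subseteq> ?U"
    using diffs_not_dvd[OF F] dist by blast+
  have ranY: "F t \<in> {Y, Z, X}" "F t \<in> {X, Z, Y}" for t using ran[of t] by auto
  have "pcard (diffs F X Y \<union> diffs F Y Z) \<le> p - 1"
    using pcard_mono[of "diffs F X Y \<union> diffs F Y Z" ?U] sub U by auto
  \<comment> \<open>This union is disjoint by \<open>diffs_no_common\<close>, so the overlap of the
    first two sets and the third set share one budget of \<open>p - 1\<close>.\<close>
  moreover have "pcard ((diffs F X Y \<inter> diffs F Y Z) \<union> diffs F X Z) \<le> p - 1"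
    using pcard_mono[of "(diffs F X Y \<inter> diffs F Y Z) \<union> diffs F X Z" ?U] sub U by auto
  moreover have "pcard (?C X) + pcard (?C Y) \<le> pcard (diffs F X Y)"
    by (rule pcard_diffs_lower[OF F rf dist ran ge2])
  moreover have "pcard (?C Y) + pcard (?C Z) \<le> pcard (diffs F Y Z)"
    by (rule pcard_diffs_lower[OF F rf dist(2) dist(3)[symmetric] dist(1)[symmetric] ranY(1) ge2(2,3,1)])
  moreover have "pcard (?C X) + pcard (?C Z) \<le> pcard (diffs F X Z)"
    by (rule pcard_diffs_lower[OF F rf dist(3) dist(2)[symmetric] dist(1) ranY(2) ge2(1,3,2)])
  ultimately show False
    using pcard_Un_Int[of "diffs F X Y" "diffs F Y Z"]
      pcard_Un_Int[of "diffs F X Y \<inter> diffs F Y Z" "diffs F X Z"]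
      diffs_no_common[OF F rf dist ran] total p_gt_2 by simp
qed

subsection \<open>Cosets of the group generated by \<open>-1\<close> and \<open>2\<close>\<close>

abbreviation nonzero :: "int set" where
  "nonzero \<equiv> {1..<int p}"

text \<open>The orbit relation on representatives \<open>1, ..., p - 1\<close>, which makes the
  cosets the classes of an equivalence on a finite set.\<close>

definition coset_rel :: "(int \<times> int) set" where
  "coset_rel = {(u, v). u \<in> nonzero \<and> v \<in> nonzero \<and>
     (\<exists>k. [v = 2 ^ k * u] (mod int p) \<or> [v = - (2 ^ k * u)] (mod int p))}"

abbreviation cosets :: "int set set" where
  "cosets \<equiv> nonzero // coset_rel"

lemma cong_2_power_iff: "[2 ^ i = (2::int) ^ j] (mod int p) \<longleftrightarrow> [i = j] (mod ord p 2)"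
proof -
  have "[2 ^ i = (2::int) ^ j] (mod int p) \<longleftrightarrow> [2 ^ i = (2::nat) ^ j] (mod p)"
    by (simp flip: cong_int_iff)
  also have "\<dots> \<longleftrightarrow> [i = j] (mod ord p 2)"
    using odd_p by (intro order_divides_expdiff) auto
  finally show ?thesis .
qed

lemma ord_2_pos: "0 < ord p 2"
  using odd_p by simp

lemma nonzero_iff: "u mod int p \<in> nonzero \<longleftrightarrow> \<not> int p dvd u"
proof -
  obtain w where w: "w = u mod int p" "0 \<le> w" "w < int p" by simp
  then show ?thesis unfolding dvd_eq_mod_eq_0 w(1)[symmetric] by auto
qed

lemma not_dvd_nonzero: "u \<in> nonzero \<Longrightarrow> \<not> int p dvd u"
  by (auto dest: zdvd_imp_le)

lemma prime_int_p: "prime (int p)"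
  using prime_p by simp

lemma coprime_int_p: "\<not> int p dvd u \<Longrightarrow> coprime u (int p)"
  using prime_imp_coprime[OF prime_int_p] by (simp add: coprime_commute)

lemma not_dvd_2_power: "\<not> int p dvd 2 ^ k"
  using not_dvd_2 prime_int_p prime_dvd_power by blast

lemma equiv_coset_rel: "equiv nonzero coset_rel"
proof (rule equivI)
  show "coset_rel \<subseteq> nonzero \<times> nonzero" by (auto simp: coset_rel_def)
  show "refl_on nonzero coset_rel"
    by (auto simp: refl_on_def coset_rel_def intro!: exI[of _ 0])
  show "sym coset_rel"
  proof (rule symI)
    fix u v assume uv: "(u, v) \<in> coset_rel"
    then obtain k where k: "[v = 2 ^ k * u] (mod int p) \<or> [v = - (2 ^ k * u)] (mod int p)"
      by (auto simp: coset_rel_def)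
    \<comment> \<open>\<open>2 ^ l\<close> inverts \<open>2 ^ k\<close> modulo \<open>p\<close>,
      because \<open>l + k\<close> is a multiple of the order of 2.\<close>
    define l where "l = k * (ord p 2 - 1)"
    have "l + k = k * ord p 2" using ord_2_pos by (cases "ord p 2") (auto simp: l_def)
    then have "[l + k = 0] (mod ord p 2)" by (simp add: cong_0_iff)
    then have "[2 ^ (l + k) = (2::int) ^ 0] (mod int p)" by (simp only: cong_2_power_iff)
    then have "[2 ^ (l + k) * u = 2 ^ 0 * u] (mod int p)" by (rule cong_scalar_right)
    then have lk: "[2 ^ l * (2 ^ k * u) = u] (mod int p)" by (simp add: power_add mult.assoc)
    from k have "[u = 2 ^ l * v] (mod int p) \<or> [u = - (2 ^ l * v)] (mod int p)"
    proof
      assume "[v = 2 ^ k * u] (mod int p)"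
      then have "[2 ^ l * v = 2 ^ l * (2 ^ k * u)] (mod int p)" by (rule cong_scalar_left)
      then show ?thesis using lk by (meson cong_trans cong_sym)
    next
      assume "[v = - (2 ^ k * u)] (mod int p)"
      then have "[- (2 ^ l) * v = - (2 ^ l) * - (2 ^ k * u)] (mod int p)" by (rule cong_scalar_left)
      then have "[- (2 ^ l * v) = 2 ^ l * (2 ^ k * u)] (mod int p)" by simp
      then show ?thesis using lk by (meson cong_trans cong_sym)
    qed
    then show "(v, u) \<in> coset_rel" using uv by (auto simp: coset_rel_def)
  qed
  show "trans coset_rel"
  proof (rule transI)
    fix u v w assume uvw: "(u, v) \<in> coset_rel" "(v, w) \<in> coset_rel"
    have ex: "\<exists>k s. [b = s * (2 ^ k * a)] (mod int p) \<and> (s = 1 \<or> s = -1)"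
      if ab: "(a, b) \<in> coset_rel" for a b
    proof -
      obtain k where "[b = 2 ^ k * a] (mod int p) \<or> [b = - (2 ^ k * a)] (mod int p)"
        using ab by (auto simp: coset_rel_def)
      then have "[b = 1 * (2 ^ k * a)] (mod int p) \<or> [b = - 1 * (2 ^ k * a)] (mod int p)" by simp
      then show ?thesis by blast
    qed
    obtain k s where k: "[v = s * (2 ^ k * u)] (mod int p)" "s = 1 \<or> s = -1"
      using ex[OF uvw(1)] by blast
    obtain l t where l: "[w = t * (2 ^ l * v)] (mod int p)" "t = 1 \<or> t = -1"
      using ex[OF uvw(2)] by blast
    have "[t * 2 ^ l * v = t * 2 ^ l * (s * (2 ^ k * u))] (mod int p)"
      by (rule cong_scalar_left) fact
    then have "[w = (t * s) * (2 ^ (l + k) * u)] (mod int p)"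
      using cong_trans[OF l(1)] by (simp add: power_add mult_ac)
    moreover have "t * s = 1 \<or> t * s = -1" using k l by auto
    ultimately have "[w = 2 ^ (l + k) * u] (mod int p) \<or> [w = - (2 ^ (l + k) * u)] (mod int p)"
      by (elim disjE) simp_all
    then have "\<exists>k. [w = 2 ^ k * u] (mod int p) \<or> [w = - (2 ^ k * u)] (mod int p)" by blast
    then show "(u, w) \<in> coset_rel" using uvw by (auto simp: coset_rel_def)
  qed
qed

lemma coset_of_1:
  "coset_rel `` {1} = (\<lambda>k. 2 ^ k mod int p) ` {..<ord p 2} \<union> (\<lambda>k. - (2 ^ k) mod int p) ` {..<ord p 2}"
  (is "_ = ?P \<union> ?M")
proof
  show "?P \<union> ?M \<subseteq> coset_rel `` {1}"
  proof
    fix v assume "v \<in> ?P \<union> ?M"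
    then obtain k where "v = 2 ^ k mod int p \<or> v = - (2 ^ k) mod int p" by blast
    moreover from this have "v \<in> nonzero"
      using nonzero_iff[of "2 ^ k"] nonzero_iff[of "- (2 ^ k)"] not_dvd_2_power[of k] by auto
    ultimately show "v \<in> coset_rel `` {1}"
      using p_gt_2 unfolding coset_rel_def by (auto simp: cong_def)
  qed
  show "coset_rel `` {1} \<subseteq> ?P \<union> ?M"
  proof
    fix v assume "v \<in> coset_rel `` {1}"
    then obtain k where v: "v \<in> nonzero" "[v = 2 ^ k] (mod int p) \<or> [v = - (2 ^ k)] (mod int p)"
      by (auto simp: coset_rel_def)
    define l where "l = k mod ord p 2"
    have l: "l < ord p 2" using ord_2_pos by (simp add: l_def)
    have kl: "[2 ^ k = (2::int) ^ l] (mod int p)" unfolding cong_2_power_iff l_def by (simp add: cong_def)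
    have "[- (2 ^ k) = - ((2::int) ^ l)] (mod int p)" using kl by (simp add: cong_minus_minus_iff)
    then have "[v = 2 ^ l] (mod int p) \<or> [v = - (2 ^ l)] (mod int p)"
      using v kl by (meson cong_trans)
    then have "v mod int p \<in> ?P \<union> ?M" using l by (auto simp: cong_def)
    then show "v \<in> ?P \<union> ?M" using v by simp
  qed
qed

text \<open>The question is whether \<open>-1\<close> is a power of 2. If the order is
  \<open>2 * h\<close>, then \<open>2 ^ h\<close> is a square root of 1 other than 1, hence
  \<open>-1\<close>. If the order is odd, squaring \<open>2 ^ i = - (2 ^ j)\<close> forces
  \<open>i\<close> and \<open>j\<close> to agree modulo the order, which is absurd. This is the
  source of the factor \<open>c\<close> in the main result.\<close>

lemma card_coset_1: "card (coset_rel `` {1}) = (if even (ord p 2) then 1 else 2) * ord p 2"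
proof -
  let ?n = "ord p 2"
  let ?P = "(\<lambda>k. 2 ^ k mod int p) ` {..<?n}" and ?M = "(\<lambda>k. - (2 ^ k) mod int p) ` {..<?n}"
  have inj: "i = j" if "i < ?n" "j < ?n" "[2 ^ i = (2::int) ^ j] (mod int p)" for i j
    using that unfolding cong_2_power_iff by (simp add: cong_def)
  have P: "card ?P = ?n"
    using inj by (subst card_image) (auto simp: inj_on_def cong_def)
  have inj': "i = j" if "i < ?n" "j < ?n" "[- (2 ^ i) = - ((2::int) ^ j)] (mod int p)" for i j
    using inj that by (simp add: cong_minus_minus_iff)
  have M: "card ?M = ?n"
    using inj' by (subst card_image) (auto simp: inj_on_def cong_def)
  show ?thesis
  proof (cases "even ?n")
    case True
    then obtain h where h: "?n = 2 * h" by (elim evenE)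
    have "[2 ^ (2 * h) = (2::int) ^ 0] (mod int p)" unfolding cong_2_power_iff by (simp add: h cong_def)
    then have "int p dvd (2 ^ h - 1) * (2 ^ h + 1)"
      by (simp add: cong_iff_dvd_diff algebra_simps power_mult power2_eq_square flip: power_mult_distrib)
    moreover have "\<not> int p dvd 2 ^ h - 1"
    proof
      assume "int p dvd 2 ^ h - 1"
      then have "[2 ^ h = (2::int) ^ 0] (mod int p)" by (simp add: cong_iff_dvd_diff)
      then have "[h = 0] (mod ?n)" by (simp only: cong_2_power_iff)
      then show False using h ord_2_pos by (auto simp: cong_0_iff dest: dvd_imp_le)
    qed
    ultimately have "int p dvd 2 ^ h + 1" using prime_dvd_multD[OF prime_int_p] by blast
    then have h1: "[- 1 = 2 ^ h] (mod int p)"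
      by (metis cong_iff_dvd_diff cong_sym diff_minus_eq_add)
    have "?M \<subseteq> ?P"
    proof
      fix v assume "v \<in> ?M"
      then obtain k where k: "v = - (2 ^ k) mod int p" by blast
      define l where "l = (h + k) mod ?n"
      have "[- 1 * 2 ^ k = 2 ^ h * 2 ^ k] (mod int p)" using h1 by (rule cong_scalar_right)
      moreover have "[2 ^ (h + k) = (2::int) ^ l] (mod int p)"
        unfolding cong_2_power_iff l_def by (simp add: cong_def)
      ultimately have "v = 2 ^ l mod int p" using k by (simp add: cong_def power_add)
      moreover have "l < ?n" using ord_2_pos by (simp add: l_def)
      ultimately show "v \<in> ?P" by blast
    qed
    then show ?thesis unfolding coset_of_1 using P True by (simp add: Un_absorb2)
  next
    case False
    have "?P \<inter> ?M = {}"
    proof (rule ccontr)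
      assume "?P \<inter> ?M \<noteq> {}"
      then obtain i j where ij: "[2 ^ i = - ((2::int) ^ j)] (mod int p)" by (auto simp: cong_def)
      then have "[2 ^ i * 2 ^ i = - ((2::int) ^ j) * - (2 ^ j)] (mod int p)" by (intro cong_mult)
      then have "[2 ^ (2 * i) = (2::int) ^ (2 * j)] (mod int p)" by (simp add: mult_2 power_add)
      then have "[2 * i = 2 * j] (mod ?n)" by (simp only: cong_2_power_iff)
      then have "[i = j] (mod ?n)" using False by (simp add: cong_mult_lcancel_nat coprime_commute)
      then have "[2 ^ i = (2::int) ^ j] (mod int p)" by (simp only: cong_2_power_iff)
      then have "[2 ^ j = - ((2::int) ^ j)] (mod int p)" using ij by (meson cong_trans cong_sym)
      then have "int p dvd 2 ^ Suc j" by (simp add: cong_iff_dvd_diff)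
      then show False using not_dvd_2_power by blast
    qed
    then show ?thesis unfolding coset_of_1 using P M False by (subst card_Un_disjoint) auto
  qed
qed

text \<open>Multiplication by \<open>u\<close> is a bijection from the coset of 1 to that of
  \<open>u\<close>.\<close>

lemma card_coset:
  assumes u: "u \<in> nonzero"
  shows "card (coset_rel `` {u}) = card (coset_rel `` {1})"
proof -
  let ?h = "\<lambda>x. x * u mod int p"
  have cop: "coprime u (int p)" using coprime_int_p not_dvd_nonzero u by blast
  have "inj_on ?h (coset_rel `` {1})"
  proof (rule inj_onI)
    fix x y assume xy: "x \<in> coset_rel `` {1}" "y \<in> coset_rel `` {1}" "?h x = ?h y"
    then have "[x = y] (mod int p)" using cop by (simp add: cong_def[symmetric] cong_mult_rcancel)
    moreover have "x \<in> nonzero" "y \<in> nonzero" using xy by (auto simp: coset_rel_def)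
    ultimately show "x = y" by (simp add: cong_def)
  qed
  moreover have "?h ` (coset_rel `` {1}) = coset_rel `` {u}"
  proof
    show "?h ` (coset_rel `` {1}) \<subseteq> coset_rel `` {u}"
    proof
      fix v assume "v \<in> ?h ` (coset_rel `` {1})"
      then obtain x where x: "v = x * u mod int p" "(1, x) \<in> coset_rel" by auto
      then obtain k where k: "[x = 2 ^ k] (mod int p) \<or> [x = - (2 ^ k)] (mod int p)"
        by (auto simp: coset_rel_def)
      have "[x * u = 2 ^ k * u] (mod int p) \<or> [x * u = - (2 ^ k) * u] (mod int p)"
        using k cong_scalar_right by blast
      then have "[v = 2 ^ k * u] (mod int p) \<or> [v = - (2 ^ k * u)] (mod int p)"
        using x by (simp add: cong_def)
      moreover have "\<not> int p dvd x * u"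
        using x not_dvd_nonzero[of x] not_dvd_nonzero[OF u] prime_dvd_multD[OF prime_int_p]
        by (auto simp: coset_rel_def)
      ultimately show "v \<in> coset_rel `` {u}"
        using u x nonzero_iff[of "x * u"] by (auto simp: coset_rel_def)
    qed
    show "coset_rel `` {u} \<subseteq> ?h ` (coset_rel `` {1})"
    proof
      fix v assume "v \<in> coset_rel `` {u}"
      then obtain k where v: "v \<in> nonzero" "[v = 2 ^ k * u] (mod int p) \<or> [v = - (2 ^ k) * u] (mod int p)"
        by (auto simp: coset_rel_def)
      then obtain s where s: "[v = s * u] (mod int p)" "s = 2 ^ k \<or> s = - (2 ^ k)" by blast
      have "(1, s mod int p) \<in> coset_rel"
        using s(2) nonzero_iff[of s] not_dvd_2_power[of k] p_gt_2
        unfolding coset_rel_def by (auto simp: cong_def)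
      moreover have "v = ?h (s mod int p)" using s(1) v(1) by (simp add: cong_def mod_mult_left_eq)
      ultimately show "v \<in> ?h ` (coset_rel `` {1})" by blast
    qed
  qed
  ultimately show ?thesis using card_image by metis
qed

lemma finite_cosets: "finite cosets"
  by (rule finite_quotient) (use equiv_coset_rel in \<open>auto simp: equiv_def\<close>)

text \<open>The cosets partition the \<open>p - 1\<close> nonzero residues into classes of equal
  size; their number is the exponent in the final formula.\<close>

lemma card_cosets: "p - 1 = (if even (ord p 2) then 1 else 2) * ord p 2 * card cosets"
proof -
  have "card (coset_rel `` {1}) * card cosets = card (\<Union> cosets)"
  proof (rule card_partition)
    show "finite cosets" by (rule finite_cosets)
    show "finite (\<Union> cosets)" unfolding Union_quotient[OF equiv_coset_rel] by simp
    show "card C = card (coset_rel `` {1})" if "C \<in> cosets" for C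
      using that by (rule quotientE) (metis card_coset)
    show "C \<inter> D = {}" if "C \<in> cosets" "D \<in> cosets" "C \<noteq> D" for C D
      using quotient_disj[OF equiv_coset_rel that(1,2)] that(3) by blast
  qed
  then show ?thesis unfolding Union_quotient[OF equiv_coset_rel] card_coset_1 by simp
qed

subsection \<open>Colorings with at least three colors\<close>

text \<open>Lifts a coloring of residues to a periodic coloring of the integers, where the results
  on \<open>int_rainbow_free\<close> apply.\<close>

definition ext :: "(nat \<Rightarrow> 'a) \<Rightarrow> int \<Rightarrow> 'a" where
  "ext f x = f (nat (x mod int p))"

lemma ext_of_nat: "x < p \<Longrightarrow> ext f (int x) = f x"
  by (simp add: ext_def)

lemma periodic_ext: "periodic_fun (ext f)"
  by (simp add: periodic_fun_def ext_def cong_def)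

lemma ext_cong: "[x = y] (mod int p) \<Longrightarrow> ext f x = ext f y"
  by (rule periodic_funD[OF periodic_ext])

lemma range_ext: "range (ext f) = f ` {0..<p}"
proof
  show "range (ext f) \<subseteq> f ` {0..<p}" by (auto simp: ext_def nat_less_iff)
  show "f ` {0..<p} \<subseteq> range (ext f)"
  proof
    fix c assume "c \<in> f ` {0..<p}"
    then obtain x where "x < p" "c = f x" by auto
    then have "c = ext f (int x)" by (simp add: ext_of_nat)
    then show "c \<in> range (ext f)" by blast
  qed
qed

text \<open>Reducing an integer progression gives a 3-AP of residues; conversely a 3-AP
  \<open>a, b, c\<close> lifts to the exact progression \<open>a, b, 2 * b - a\<close>, whose last
  term is congruent to \<open>c\<close>.\<close>

lemma rainbow_3AP_free_iff: "rainbow_3AP_free p f \<longleftrightarrow> int_rainbow_free (ext f)"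
proof
  assume free: "rainbow_3AP_free p f"
  show "int_rainbow_free (ext f)"
    unfolding int_rainbow_free_def
  proof (intro allI impI)
    fix x y z :: int
    assume xyz: "x + z = 2 * y"
    define a b c where abc: "a = nat (x mod int p)" "b = nat (y mod int p)" "c = nat (z mod int p)"
    have "[int a + int c = 2 * int b] (mod int p)"
      using xyz by (simp add: abc cong_def mod_simps)
    then have "[a + c = 2 * b] (mod p)"
      by (simp flip: cong_int_iff)
    then have "three_AP p a b c" by (auto simp: three_AP_def abc nat_less_iff)
    then show "ext f x = ext f y \<or> ext f y = ext f z \<or> ext f x = ext f z"
      using free unfolding rainbow_3AP_free_def ext_def abc by blast
  qed
next
  assume rf: "int_rainbow_free (ext f)"
  show "rainbow_3AP_free p f"
    unfolding rainbow_3AP_free_def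
  proof (intro notI, elim exE conjE)
    fix a b c assume ap: "three_AP p a b c" and ne: "f a \<noteq> f b" "f b \<noteq> f c" "f a \<noteq> f c"
    then have lt: "a < p" "b < p" "c < p" and "[a + c = 2 * b] (mod p)" by (auto simp: three_AP_def)
    then have "[int (a + c) = int (2 * b)] (mod int p)" by (simp only: cong_int_iff)
    then have "[2 * int b - int a = int c] (mod int p)"
      by (auto simp: cong_iff_dvd_diff algebra_simps dvd_diff_commute)
    then have "ext f (2 * int b - int a) = f c" using ext_cong ext_of_nat[OF lt(3)] by metis
    then show False
      using int_rainbow_freeD[OF rf, of "int a" "2 * int b - int a" "int b"] ne lt by (simp add: ext_of_nat)
  qed
qed

text \<open>Merging all further colors into \<open>l\<close> keeps the coloring rainbow-free and
  shrinks none of the three classes.\<close>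

lemma no_three_large_classes:
  assumes F: "periodic_fun F" and rf: "int_rainbow_free F" and dist: "j \<noteq> k" "k \<noteq> l" "j \<noteq> l"
    and ge2: "2 \<le> pcard {x. F x = j}" "2 \<le> pcard {x. F x = k}" "2 \<le> pcard {x. F x = l}"
  shows False
proof -
  define m where "m c = (if c = j then j else if c = k then k else l)" for c
  show False
  proof (rule rainbow_free_small_class[of "\<lambda>t. m (F t)" j k l])
    show "periodic_fun (\<lambda>t. m (F t))" using F unfolding periodic_fun_def by metis
    show "int_rainbow_free (\<lambda>t. m (F t))" using rf unfolding int_rainbow_free_def by metis
    show "m (F t) \<in> {j, k, l}" for t by (simp add: m_def)
    have "{x. m (F x) = j} = {x. F x = j}" "{x. m (F x) = k} = {x. F x = k}"
      using dist by (auto simp: m_def)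
    then show "2 \<le> pcard {x. m (F x) = j}" "2 \<le> pcard {x. m (F x) = k}" using ge2 by simp_all
    have "pcard {x. F x = l} \<le> pcard {x. m (F x) = l}" using dist by (intro pcard_mono) (auto simp: m_def)
    then show "2 \<le> pcard {x. m (F x) = l}" using ge2 by simp
  qed (use dist in auto)
qed

lemma dvd_double_iff: "int p dvd 2 * u \<longleftrightarrow> int p dvd u"
  using not_dvd_2 prime_dvd_mult_iff[OF prime_int_p] by blast

lemma not_cong_uminus:
  assumes "\<not> int p dvd u"
  shows "\<not> [x + u = x - u] (mod int p)"
proof
  assume "[x + u = x - u] (mod int p)"
  then have "int p dvd 2 * u" by (simp add: cong_iff_dvd_diff)
  then show False using assms dvd_double_iff by blast
qed

text \<open>Accepts any integer, so that it can be applied to differences \<open>y - x0\<close>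
  directly.\<close>

definition coset :: "int \<Rightarrow> int set" where
  "coset u = coset_rel `` {u mod int p}"

lemma coset_cong: "[u = v] (mod int p) \<Longrightarrow> coset u = coset v"
  by (simp add: coset_def cong_def)

lemma coset_in_cosets: "\<not> int p dvd u \<Longrightarrow> coset u \<in> cosets"
  unfolding coset_def using nonzero_iff[of u] by (auto intro: quotientI)

lemma cosets_cases:
  assumes "C \<in> cosets"
  obtains u where "u \<in> nonzero" "C = coset u"
  using assms by (rule quotientE) (rule that, auto simp: coset_def)

lemma coset_eqI:
  assumes "\<not> int p dvd u" "[v = 2 ^ k * u] (mod int p) \<or> [v = - (2 ^ k * u)] (mod int p)"
  shows "coset v = coset u"
proof -
  have "\<not> int p dvd 2 ^ k * u"
    using assms not_dvd_2_power prime_dvd_multD[OF prime_int_p] by blast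
  then have "\<not> int p dvd v" using assms(2) by (auto simp: cong_dvd_iff)
  have *: "[2 ^ k * u = 2 ^ k * (u mod int p)] (mod int p)"
    by (simp add: cong_def mod_simps)
  moreover have "[- (2 ^ k * u) = - (2 ^ k * (u mod int p))] (mod int p)"
    using * by (simp only: cong_minus_minus_iff)
  ultimately have "[v = 2 ^ k * (u mod int p)] (mod int p) \<or> [v = - (2 ^ k * (u mod int p))] (mod int p)"
    using assms(2) by (meson cong_trans)
  then have "[v mod int p = 2 ^ k * (u mod int p)] (mod int p) \<or>
      [v mod int p = - (2 ^ k * (u mod int p))] (mod int p)"
    by (simp add: cong_def)
  with \<open>\<not> int p dvd v\<close> have "(u mod int p, v mod int p) \<in> coset_rel"
    using assms(1) nonzero_iff unfolding coset_rel_def by blast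
  then show ?thesis unfolding coset_def using equiv_class_eq[OF equiv_coset_rel] by metis
qed

section \<open>Colorings constant on translated cosets\<close>

definition centered :: "nat \<Rightarrow> 'a \<Rightarrow> (int set \<Rightarrow> 'a) \<Rightarrow> nat \<Rightarrow> 'a" where
  "centered x0 i h = (\<lambda>y\<in>{0..<p}. if y = x0 then i else h (coset (int y - int x0)))"

text \<open>For \<open>i\<close> outside \<open>P\<close>, the color \<open>i\<close> is used at
  \<open>x0\<close> only. Requiring that all of \<open>P\<close> is attained lets the coloring
  determine \<open>P\<close>.\<close>

definition centered_colorings :: "nat \<Rightarrow> 'a \<Rightarrow> 'a set \<Rightarrow> (nat \<Rightarrow> 'a) set" where
  "centered_colorings x0 i P = centered x0 i ` {h \<in> cosets \<rightarrow>\<^sub>E P. h ` cosets = P}"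

lemma ext_centered:
  assumes "x0 < p"
  shows "ext (centered x0 i h) (int x0 + u) = (if int p dvd u then i else h (coset u))"
proof -
  define y where "y = nat ((int x0 + u) mod int p)"
  have y: "y < p" "[int y = int x0 + u] (mod int p)" by (auto simp: y_def nat_less_iff)
  have "y = x0 \<longleftrightarrow> [int y = int x0] (mod int p)" using y(1) assms unfolding cong_int_iff by (simp add: cong_def)
  also have "\<dots> \<longleftrightarrow> [int x0 + u = int x0] (mod int p)" using y by (meson cong_trans cong_sym)
  also have "\<dots> \<longleftrightarrow> int p dvd u" by (simp add: cong_iff_dvd_diff)
  finally have "y = x0 \<longleftrightarrow> int p dvd u" .
  moreover have "coset (int y - int x0) = coset u"
    using cong_diff[OF y(2) cong_refl, of "int x0"] by (intro coset_cong) simp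
  moreover have "ext (centered x0 i h) (int x0 + u) = centered x0 i h y" by (simp add: ext_def y_def)
  ultimately show ?thesis using y by (simp add: centered_def)
qed

lemma inj_on_centered:
  assumes "x0 < p"
  shows "inj_on (centered x0 i) {h \<in> cosets \<rightarrow>\<^sub>E P. h ` cosets = P}"
proof (rule inj_onI)
  fix h h' assume h: "h \<in> {h \<in> cosets \<rightarrow>\<^sub>E P. h ` cosets = P}" "h' \<in> {h \<in> cosets \<rightarrow>\<^sub>E P. h ` cosets = P}"
    and eq: "centered x0 i h = centered x0 i h'"
  show "h = h'"
  proof (rule PiE_ext)
    show "h \<in> cosets \<rightarrow>\<^sub>E P" "h' \<in> cosets \<rightarrow>\<^sub>E P" using h by auto
    fix C assume "C \<in> cosets"
    then obtain u where u: "u \<in> nonzero" "C = coset u" by (rule cosets_cases)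
    then show "h C = h' C"
      using ext_centered[OF assms, of i h u] ext_centered[OF assms, of i h' u] eq not_dvd_nonzero[of u]
      by simp
  qed
qed

lemma cosets_nonempty: "cosets \<noteq> {}"
  using p_gt_2 by (auto simp: quotient_is_empty)

lemma card_centered_colorings:
  assumes "x0 < p" "card P = 2"
  shows "card (centered_colorings x0 i P) = 2 ^ card cosets - 2"
  unfolding centered_colorings_def card_image[OF inj_on_centered[OF assms(1)]]
  by (rule card_onto_doubleton[OF finite_cosets cosets_nonempty assms(2)])

lemma centered_colorings_range:
  assumes x0: "x0 < p" and f: "f \<in> centered_colorings x0 i P"
  shows "range (ext f) = insert i P"
proof -
  obtain h where h: "f = centered x0 i h" "h ` cosets = P"
    using f by (auto simp: centered_colorings_def)
  have e: "ext f (int x0 + u) = (if int p dvd u then i else h (coset u))" for u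
    unfolding h(1) by (rule ext_centered[OF x0])
  show ?thesis
  proof
    show "range (ext f) \<subseteq> insert i P"
    proof
      fix c assume "c \<in> range (ext f)"
      then obtain x where "c = ext f (int x0 + (x - int x0))" by auto
      then show "c \<in> insert i P" unfolding e using h(2) coset_in_cosets by auto
    qed
    show "insert i P \<subseteq> range (ext f)"
    proof
      fix c assume c: "c \<in> insert i P"
      show "c \<in> range (ext f)"
      proof (cases "c = i")
        case True
        then show ?thesis using e[of 0] by (metis dvd_0_right rangeI)
      next
        case False
        then obtain C where "C \<in> cosets" "c = h C" using c h by auto
        then obtain u where "u \<in> nonzero" "c = h (coset u)" by (metis cosets_cases)
        then have "c = ext f (int x0 + u)" using e[of u] not_dvd_nonzero[of u] by simp
        then show ?thesis by blast
      qed
    qed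
  qed
qed

lemma centered_colorings_center:
  assumes x0: "x0 < p" and f: "f \<in> centered_colorings x0 i P" and "i \<notin> P"
  shows "ext f (int x0 + u) = i \<longleftrightarrow> int p dvd u"
proof -
  obtain h where h: "f = centered x0 i h" "h ` cosets = P"
    using f by (auto simp: centered_colorings_def)
  then show ?thesis using ext_centered[OF x0, of i h u] coset_in_cosets[of u] \<open>i \<notin> P\<close> by auto
qed

lemma centered_colorings_invariant:
  assumes x0: "x0 < p" and f: "f \<in> centered_colorings x0 i P"
  shows "ext f (int x0 + 2 * u) = ext f (int x0 + u)" "ext f (int x0 - u) = ext f (int x0 + u)"
proof -
  obtain h where h: "f = centered x0 i h" using f by (auto simp: centered_colorings_def)
  have e: "ext f (int x0 + u) = (if int p dvd u then i else h (coset u))" for u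
    unfolding h(1) by (rule ext_centered[OF x0])
  show "ext f (int x0 + 2 * u) = ext f (int x0 + u)"
    unfolding e dvd_double_iff using coset_eqI[of u "2 * u" 1] by auto
  have "ext f (int x0 + - u) = ext f (int x0 + u)"
    unfolding e using coset_eqI[of u "- u" 0] by auto
  then show "ext f (int x0 - u) = ext f (int x0 + u)" by simp
qed

text \<open>A rainbow triple needs three colors, so one term is congruent to \<open>x0\<close>. The
  other two terms are then related by doubling or by reflection about \<open>x0\<close> and share
  their color.\<close>

lemma centered_colorings_free:
  assumes x0: "x0 < p" and f: "f \<in> centered_colorings x0 i P" and "card P = 2"
  shows "int_rainbow_free (ext f)"
  unfolding int_rainbow_free_def
proof (intro allI impI, rule ccontr)
  fix x y z :: int
  assume xyz: "x + z = 2 * y" and rainbow: "\<not> (ext f x = ext f y \<or> ext f y = ext f z \<or> ext f x = ext f z)"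
  have fin: "finite P" using \<open>card P = 2\<close> card.infinite by fastforce
  have "{ext f x, ext f y, ext f z} \<subseteq> insert i P"
    using centered_colorings_range[OF x0 f] by blast
  moreover have "\<not> {ext f x, ext f y, ext f z} \<subseteq> P"
  proof
    assume "{ext f x, ext f y, ext f z} \<subseteq> P"
    then have "card {ext f x, ext f y, ext f z} \<le> 2" using fin \<open>card P = 2\<close> card_mono by metis
    then show False using rainbow by auto
  qed
  moreover have zero: "int p dvd t - int x0" if "ext f t = i" "i \<notin> P" for t
    using centered_colorings_center[OF x0 f that(2), of "t - int x0"] that by simp
  ultimately have i: "i \<notin> P" and "ext f x = i \<or> ext f y = i \<or> ext f z = i" by auto
  then consider "int p dvd x - int x0" | "int p dvd y - int x0" | "int p dvd z - int x0"
    using zero by blast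
  then show False
  proof cases
    case 1
    have "z - (int x0 + 2 * (y - int x0)) = - (x - int x0)" using xyz by simp
    then have "ext f z = ext f (int x0 + 2 * (y - int x0))"
      using 1 by (intro ext_cong) (simp only: cong_iff_dvd_diff dvd_minus_iff)
    also have "\<dots> = ext f y" using centered_colorings_invariant(1)[OF x0 f, of "y - int x0"] by simp
    finally show False using rainbow by simp
  next
    case 2
    have "z - (int x0 - (x - int x0)) = 2 * (y - int x0)" using xyz by simp
    moreover have "int p dvd 2 * (y - int x0)" using 2 by (rule dvd_mult)
    ultimately have "ext f z = ext f (int x0 - (x - int x0))"
      by (intro ext_cong) (simp only: cong_iff_dvd_diff)
    also have "\<dots> = ext f x" using centered_colorings_invariant(2)[OF x0 f, of "x - int x0"] by simp
    finally show False using rainbow by simp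
  next
    case 3
    have "x - (int x0 + 2 * (y - int x0)) = - (z - int x0)" using xyz by simp
    then have "ext f x = ext f (int x0 + 2 * (y - int x0))"
      using 3 by (intro ext_cong) (simp only: cong_iff_dvd_diff dvd_minus_iff)
    also have "\<dots> = ext f y" using centered_colorings_invariant(1)[OF x0 f, of "y - int x0"] by simp
    finally show False using rainbow by simp
  qed
qed

text \<open>Reflection about \<open>x0\<close> preserves colors and fixes only the class of
  \<open>x0\<close>. If \<open>i \<noteq> j\<close>, it would carry the only residue colored
  \<open>j\<close> to another one.\<close>

lemma centered_colorings_unique:
  assumes x: "x0 < p" "x1 < p" and f: "f \<in> centered_colorings x0 i P" "f \<in> centered_colorings x1 j Q"
    and ij: "i \<notin> P" "j \<notin> Q"
  shows "i = j" "x0 = x1" "P = Q"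
proof -
  note c = centered_colorings_center[OF x(1) f(1) ij(1)] centered_colorings_center[OF x(2) f(2) ij(2)]
  show eq: "i = j"
  proof (rule ccontr)
    assume "i \<noteq> j"
    obtain u where u: "u = int x1 - int x0" by simp
    have "ext f (int x0 + u) = j" using c(2)[of 0] u by simp
    then have "\<not> int p dvd u" "ext f (int x0 - u) = j"
      using c(1)[of u] \<open>i \<noteq> j\<close> centered_colorings_invariant(2)[OF x(1) f(1), of u] by auto
    then have "int p dvd - (2 * u)" using c(2)[of "- (2 * u)"] u by simp
    then show False using \<open>\<not> int p dvd u\<close> by (simp add: dvd_double_iff)
  qed
  have "int p dvd int x1 - int x0" using c(1)[of "int x1 - int x0"] c(2)[of 0] eq by simp
  then have "[x1 = x0] (mod p)" by (simp add: cong_iff_dvd_diff flip: cong_int_iff)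
  then show "x0 = x1" using x by (simp add: cong_def)
  have "insert i P = insert j Q"
    using centered_colorings_range[OF x(1) f(1)] centered_colorings_range[OF x(2) f(2)] by simp
  then show "P = Q" using eq ij by (simp add: insert_ident)
qed

text \<open>Among any three colors one has a single residue, which yields \<open>i\<close> and
  \<open>x0\<close>. Every other color is large by reflection about \<open>x0\<close>, so exactly
  two others occur.\<close>

lemma centered_colorings_exhaust:
  assumes f: "f \<in> extensional {0..<p}" and rf: "int_rainbow_free (ext f)" and "3 \<le> card (f ` {0..<p})"
  obtains x0 i P where "x0 < p" "insert i P = f ` {0..<p}" "i \<notin> P" "card P = 2"
    "f \<in> centered_colorings x0 i P"
proof -
  let ?S = "f ` {0..<p}"
  define F where "F = ext f"
  have F: "periodic_fun F" unfolding F_def by (rule periodic_ext)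
  have rf: "int_rainbow_free F" using rf by (simp add: F_def)
  have S: "?S = range F" by (simp add: F_def range_ext)
  have three: "\<exists>j k l. {j, k, l} \<subseteq> T \<and> j \<noteq> k \<and> k \<noteq> l \<and> j \<noteq> l" if T: "3 \<le> card T" for T :: "'a set"
  proof -
    obtain T' where "T' \<subseteq> T" "card T' = 3" using T obtain_subset_with_card_n by metis
    then show ?thesis by (auto simp: card_3_iff)
  qed
  have small: "\<exists>i\<in>T. \<not> 2 \<le> pcard {x. F x = i}" if T: "3 \<le> card T" for T
  proof (rule ccontr)
    assume big: "\<not> ?thesis"
    obtain j k l where jkl: "{j, k, l} \<subseteq> T" "j \<noteq> k" "k \<noteq> l" "j \<noteq> l" using three[OF T] by blast
    show False by (rule no_three_large_classes[OF F rf jkl(2-4)]) (use big jkl(1) in auto)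
  qed
  obtain i where i: "i \<in> ?S" "\<not> 2 \<le> pcard {x. F x = i}" using small assms(3) by blast
  then obtain x0 where x0: "x0 < p" "f x0 = i" by auto
  have Fx0: "F (int x0) = i" using x0 by (simp add: F_def ext_of_nat)
  have center: "F (int x0 + u) = i \<longleftrightarrow> int p dvd u" for u
  proof
    assume u: "F (int x0 + u) = i"
    have "[int x0 + u = int x0] (mod int p)"
    proof (rule ccontr)
      assume "\<not> ?thesis"
      then have "2 \<le> pcard {x. F x = i}"
        using u Fx0 by (intro pcard_ge_2I[OF periodic_color_class[OF F]]) auto
      then show False using i by simp
    qed
    then show "int p dvd u" by (simp add: cong_iff_dvd_diff)
  next
    assume "int p dvd u"
    then have "F (int x0 + u) = F (int x0)" by (intro periodic_funD[OF F]) (simp add: cong_iff_dvd_diff)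
    then show "F (int x0 + u) = i" using Fx0 by simp
  qed
  \<comment> \<open>In the progression \<open>x0, x0 + u, x0 + 2 * u\<close> with \<open>u\<close>
    nonzero modulo \<open>p\<close>, only the first term has color \<open>i\<close>, so the other
    two agree.\<close>
  have dbl: "F (int x0 + 2 * u) = F (int x0 + u)" for u
  proof -
    have "int x0 + (int x0 + 2 * u) = 2 * (int x0 + u)" by simp
    then show ?thesis
      using int_rainbow_freeD[OF rf] Fx0 center[of u] center[of "2 * u"] dvd_double_iff by metis
  qed
  have neg: "F (int x0 - u) = F (int x0 + u)" for u
  proof -
    have "(int x0 + - u) + (int x0 + u) = 2 * int x0" by simp
    then have "F (int x0 + - u) = F (int x0 + u)"
      using int_rainbow_freeD[OF rf] Fx0 center[of u] center[of "- u"] dvd_minus_iff by metis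
    then show ?thesis by simp
  qed
  have pow: "F (int x0 + 2 ^ k * u) = F (int x0 + u)" for k u
  proof (induction k)
    case (Suc k)
    then show ?case using dbl[of "2 ^ k * u"] by (simp add: mult.assoc)
  qed simp
  have const: "F (int x0 + v) = F (int x0 + u)" if "(u, v) \<in> coset_rel" for u v
  proof -
    obtain k where "[v = 2 ^ k * u] (mod int p) \<or> [v = - (2 ^ k * u)] (mod int p)"
      using \<open>(u, v) \<in> coset_rel\<close> by (auto simp: coset_rel_def)
    then have "F (int x0 + v) = F (int x0 + 2 ^ k * u) \<or> F (int x0 + v) = F (int x0 + - (2 ^ k * u))"
      using periodic_funD[OF F cong_add[OF cong_refl]] by blast
    then show ?thesis using pow neg[of "2 ^ k * u"] by auto
  qed
  define P where "P = ?S - {i}"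
  have large: "2 \<le> pcard {x. F x = j}" if j: "j \<in> P" for j
  proof -
    obtain x where x: "F x = j" using j S by (auto simp: P_def)
    define u where "u = x - int x0"
    have u: "F (int x0 + u) = j" "F (int x0 - u) = j" using x neg[of u] by (simp_all add: u_def)
    then have "\<not> int p dvd u" using center[of u] j by (auto simp: P_def)
    from not_cong_uminus[OF this] show ?thesis
      by (rule pcard_ge_2I[OF periodic_color_class[OF F], rotated 2]) (use u in auto)
  qed
  have "Suc (card P) = card ?S" unfolding P_def by (rule card_Suc_Diff1) (use i in auto)
  moreover have "\<not> 3 \<le> card P" using small large by blast
  ultimately have "card P = 2" using assms(3) by linarith
  \<comment> \<open>The choice of representative is harmless, since \<open>const\<close> makes the
    color the same throughout a coset.\<close>
  define h where "h = (\<lambda>C\<in>cosets. F (int x0 + (SOME u. u \<in> C)))"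
  have h: "h (coset u) = F (int x0 + u)" if "\<not> int p dvd u" for u
  proof -
    define u' where "u' = u mod int p"
    have u': "u' \<in> nonzero" using that nonzero_iff by (simp add: u'_def)
    then have "u' \<in> coset u"
      unfolding coset_def u'_def by (rule equiv_class_self[OF equiv_coset_rel])
    then have "(SOME v. v \<in> coset u) \<in> coset u" by (rule someI)
    then have "(u', SOME v. v \<in> coset u) \<in> coset_rel" by (simp add: coset_def u'_def)
    then have "F (int x0 + (SOME v. v \<in> coset u)) = F (int x0 + u')" by (rule const)
    also have "\<dots> = F (int x0 + u)"
      by (intro periodic_funD[OF F] cong_add) (auto simp: u'_def)
    finally show ?thesis using coset_in_cosets[OF that] by (simp add: h_def)
  qed
  have hP: "h ` cosets = P"
  proof
    show "h ` cosets \<subseteq> P"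
    proof
      fix c assume "c \<in> h ` cosets"
      then obtain u where "u \<in> nonzero" "c = h (coset u)" by (auto elim: cosets_cases)
      then have "c = F (int x0 + u)" "\<not> int p dvd u" using h[of u] not_dvd_nonzero[of u] by auto
      then show "c \<in> P" using center[of u] S by (auto simp: P_def)
    qed
    show "P \<subseteq> h ` cosets"
    proof
      fix c assume c: "c \<in> P"
      then obtain x where x: "F (int x0 + (x - int x0)) = c" using S by (auto simp: P_def)
      then have "\<not> int p dvd x - int x0" using center[of "x - int x0"] c by (auto simp: P_def)
      then have "h (coset (x - int x0)) = c" "coset (x - int x0) \<in> cosets"
        using h x by (simp_all add: coset_in_cosets)
      then show "c \<in> h ` cosets" by (metis imageI)
    qed
  qed
  have "centered x0 i h = f"
  proof
    fix y show "centered x0 i h y = f y"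
    proof (cases "y < p")
      case True
      have "int p dvd int y - int x0 \<longleftrightarrow> [y = x0] (mod p)"
        by (simp add: cong_iff_dvd_diff flip: cong_int_iff)
      then have "int p dvd int y - int x0 \<longleftrightarrow> y = x0" using True x0 by (simp add: cong_def)
      moreover have "F (int y) = f y" using True by (simp add: F_def ext_of_nat)
      ultimately show ?thesis using True h[of "int y - int x0"] x0 by (simp add: centered_def)
    next
      case False
      then show ?thesis using f by (simp add: centered_def extensional_def)
    qed
  qed
  moreover have "h \<in> cosets \<rightarrow>\<^sub>E P" using hP by (auto simp: h_def)
  ultimately have "f \<in> centered_colorings x0 i P"
    using hP unfolding centered_colorings_def by blast
  then show thesis
    using that[of x0 i P] x0 \<open>card P = 2\<close> i by (auto simp: P_def)
qed

subsection \<open>Counting\<close>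

lemma colorings_onto:
  assumes "P \<subseteq> {1..r}"
  shows "{f \<in> colorings r p. f ` {0..<p} = P} = {f \<in> {0..<p} \<rightarrow>\<^sub>E P. f ` {0..<p} = P}"
  using assms by (auto simp: colorings_def PiE_def image_subset_iff_funcset[symmetric])

lemma card_colorings_onto_size:
  "card {f \<in> colorings r p. card (f ` {0..<p}) = n} =
     (\<Sum>P | P \<subseteq> {1..r} \<and> card P = n. card {f \<in> {0..<p} \<rightarrow>\<^sub>E P. f ` {0..<p} = P})"
proof -
  let ?I = "{P. P \<subseteq> {1..r} \<and> card P = n}"
  have "{f \<in> colorings r p. card (f ` {0..<p}) = n} = (\<Union>P\<in>?I. {f \<in> colorings r p. f ` {0..<p} = P})"
    by (auto simp: colorings_def)
  also have "card \<dots> = (\<Sum>P\<in>?I. card {f \<in> colorings r p. f ` {0..<p} = P})"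
    by (rule card_UN_disjoint) (auto simp: colorings_def intro!: finite_PiE)
  also have "\<dots> = (\<Sum>P\<in>?I. card {f \<in> {0..<p} \<rightarrow>\<^sub>E P. f ` {0..<p} = P})"
    by (rule sum.cong) (use colorings_onto in auto)
  finally show ?thesis .
qed

lemma finite_colorings: "finite (colorings r p)"
  by (simp add: colorings_def finite_PiE)

lemma free_if_two_colors:
  assumes "card (f ` {0..<p}) \<le> 2"
  shows "rainbow_3AP_free p f"
  unfolding rainbow_3AP_free_def
proof (intro notI, elim exE conjE)
  fix a b c assume "three_AP p a b c" and ne: "f a \<noteq> f b" "f b \<noteq> f c" "f a \<noteq> f c"
  then have "{f a, f b, f c} \<subseteq> f ` {0..<p}" by (auto simp: three_AP_def)
  then have "card {f a, f b, f c} \<le> card (f ` {0..<p})" by (intro card_mono) auto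
  then show False using ne assms by auto
qed

lemma card_few_colors:
  "card {f \<in> colorings r p. card (f ` {0..<p}) \<le> 2} = r + (r choose 2) * (2 ^ p - 2)"
proof -
  have ge1: "1 \<le> card (f ` {0..<p})" for f :: "nat \<Rightarrow> nat"
    by (simp add: Suc_le_eq card_gt_0_iff)
  have "card (f ` {0..<p}) \<le> 2 \<longleftrightarrow> card (f ` {0..<p}) = 1 \<or> card (f ` {0..<p}) = 2" for f :: "nat \<Rightarrow> nat"
    using ge1[of f] by linarith
  then have "{f \<in> colorings r p. card (f ` {0..<p}) \<le> 2} =
      {f \<in> colorings r p. card (f ` {0..<p}) = 1} \<union> {f \<in> colorings r p. card (f ` {0..<p}) = 2}"
    by blast
  moreover have "card {f \<in> colorings r p. card (f ` {0..<p}) = 1} = r"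
    unfolding card_colorings_onto_size
    using n_subsets[of "{1..r}" 1] by (simp add: card_onto_singleton)
  moreover have "card {f \<in> colorings r p. card (f ` {0..<p}) = 2} = (r choose 2) * (2 ^ p - 2)"
    unfolding card_colorings_onto_size
    using n_subsets[of "{1..r}" 2] by (simp add: card_onto_doubleton)
  moreover have "card ({f \<in> colorings r p. card (f ` {0..<p}) = 1} \<union>
        {f \<in> colorings r p. card (f ` {0..<p}) = 2}) =
      card {f \<in> colorings r p. card (f ` {0..<p}) = 1} +
        card {f \<in> colorings r p. card (f ` {0..<p}) = 2}"
    by (rule card_Un_disjoint) (use finite_colorings[of r] in auto)
  ultimately show ?thesis by simp
qed

text \<open>Each such coloring arises from exactly one triple of a center color, a center and a pair
  of further colors; there are \<open>r\<close>, \<open>p\<close> and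
  \<open>(r - 1) choose 2\<close> choices.\<close>

lemma card_many_colors:
  "card {f \<in> colorings r p. rainbow_3AP_free p f \<and> 3 \<le> card (f ` {0..<p})} =
     r * p * ((r - 1) choose 2) * (2 ^ card cosets - 2)"
proof -
  let ?Ps = "\<lambda>i. {P. P \<subseteq> {1..r} - {i} \<and> card P = 2}"
  let ?I = "SIGMA i:{1..r}. {0..<p} \<times> ?Ps i"
  let ?W = "\<lambda>(i, x0, P). centered_colorings x0 i P"
  have "{f \<in> colorings r p. rainbow_3AP_free p f \<and> 3 \<le> card (f ` {0..<p})} = (\<Union>t\<in>?I. ?W t)"
  proof
    show "{f \<in> colorings r p. rainbow_3AP_free p f \<and> 3 \<le> card (f ` {0..<p})} \<subseteq> (\<Union>t\<in>?I. ?W t)"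
    proof
      fix f assume f: "f \<in> {f \<in> colorings r p. rainbow_3AP_free p f \<and> 3 \<le> card (f ` {0..<p})}"
      then have "f \<in> extensional {0..<p}" "int_rainbow_free (ext f)" "3 \<le> card (f ` {0..<p})"
        by (auto simp: colorings_def PiE_def rainbow_3AP_free_iff)
      then obtain x0 i P where W: "x0 < p" "insert i P = f ` {0..<p}" "i \<notin> P" "card P = 2"
        "f \<in> centered_colorings x0 i P" by (rule centered_colorings_exhaust)
      have "f ` {0..<p} \<subseteq> {1..r}" using f by (auto simp: colorings_def)
      then have "i \<in> {1..r}" "P \<subseteq> {1..r} - {i}" using W(2,3) by blast+
      then have "(i, x0, P) \<in> ?I" using W by simp
      then show "f \<in> (\<Union>t\<in>?I. ?W t)" using W(5) by blast
    qed
    show "(\<Union>t\<in>?I. ?W t) \<subseteq> {f \<in> colorings r p. rainbow_3AP_free p f \<and> 3 \<le> card (f ` {0..<p})}"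
    proof
      fix f assume "f \<in> (\<Union>t\<in>?I. ?W t)"
      then obtain i x0 P where W: "i \<in> {1..r}" "x0 < p" "P \<subseteq> {1..r} - {i}" "card P = 2"
        "f \<in> centered_colorings x0 i P" by auto
      have ran: "f ` {0..<p} = insert i P"
        using centered_colorings_range[OF W(2,5)] by (simp add: range_ext)
      have "f \<in> extensional {0..<p}" using W(5) by (auto simp: centered_colorings_def centered_def)
      moreover have "f ` {0..<p} \<subseteq> {1..r}" unfolding ran using W(1,3) by auto
      ultimately have "f \<in> colorings r p"
        by (simp add: colorings_def PiE_def image_subset_iff_funcset)
      moreover have "finite P" using finite_subset[OF W(3)] by simp
      then have "card (insert i P) = 3" using W(3,4) by (subst card_insert_disjoint) auto
      moreover have "rainbow_3AP_free p f"
        unfolding rainbow_3AP_free_iff by (rule centered_colorings_free[OF W(2,5,4)])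
      ultimately show "f \<in> {f \<in> colorings r p. rainbow_3AP_free p f \<and> 3 \<le> card (f ` {0..<p})}"
        using ran by simp
    qed
  qed
  also have "card (\<Union>t\<in>?I. ?W t) = (\<Sum>t\<in>?I. card (?W t))"
  proof (rule card_UN_disjoint)
    show "finite ?I" by (intro finite_SigmaI) auto
    show "\<forall>t\<in>?I. finite (?W t)"
    proof
      fix t assume "t \<in> ?I"
      then obtain i x0 P where t: "t = (i, x0, P)" "P \<subseteq> {1..r} - {i}" by auto
      then have "finite P" using finite_subset[OF t(2)] by simp
      then have "finite (cosets \<rightarrow>\<^sub>E P)" using finite_cosets by (intro finite_PiE)
      then have "finite {h \<in> cosets \<rightarrow>\<^sub>E P. h ` cosets = P}" by (rule finite_subset[rotated]) auto
      then show "finite (?W t)" using t by (simp add: centered_colorings_def)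
    qed
    show "\<forall>s\<in>?I. \<forall>t\<in>?I. s \<noteq> t \<longrightarrow> ?W s \<inter> ?W t = {}"
    proof (intro ballI impI)
      fix s t assume st: "s \<in> ?I" "t \<in> ?I" "s \<noteq> t"
      obtain i x0 P where s: "s = (i, x0, P)" by (cases s)
      then have si: "x0 < p" "i \<notin> P" using st(1) by auto
      obtain j x1 Q where t: "t = (j, x1, Q)" by (cases t)
      then have ti: "x1 < p" "j \<notin> Q" using st(2) by auto
      show "?W s \<inter> ?W t = {}"
      proof (rule ccontr)
        assume "?W s \<inter> ?W t \<noteq> {}"
        then obtain f where f: "f \<in> centered_colorings x0 i P" "f \<in> centered_colorings x1 j Q"
          using s t by auto
        show False
          using centered_colorings_unique[OF si(1) ti(1) f si(2) ti(2)] st(3) s t by simp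
      qed
    qed
  qed
  also have "\<dots> = (\<Sum>t\<in>?I. 2 ^ card cosets - 2)"
    by (rule sum.cong) (auto simp: card_centered_colorings)
  also have "\<dots> = card ?I * (2 ^ card cosets - 2)" by simp
  also have "card ?I = (\<Sum>i\<in>{1..r}. card ({0..<p} \<times> ?Ps i))"
    by (intro card_SigmaI) auto
  also have "\<dots> = (\<Sum>i\<in>{1..r}. p * ((r - 1) choose 2))"
    by (rule sum.cong) (auto simp: card_cartesian_product n_subsets)
  finally show ?thesis by (simp add: mult.assoc)
qed

lemma g_eq: "g r p = r + (r choose 2) * (2 ^ p - 2) + r * p * ((r - 1) choose 2) * (2 ^ card cosets - 2)"
proof -
  let ?A = "{f \<in> colorings r p. card (f ` {0..<p}) \<le> 2}"
  let ?B = "{f \<in> colorings r p. rainbow_3AP_free p f \<and> 3 \<le> card (f ` {0..<p})}"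
  have "{f \<in> colorings r p. rainbow_3AP_free p f} = ?A \<union> ?B"
    using free_if_two_colors by (auto simp: not_le)
  moreover have "card (?A \<union> ?B) = card ?A + card ?B"
    by (rule card_Un_disjoint) (use finite_colorings[of r] in auto)
  ultimately show ?thesis
    unfolding g_def by (simp only: card_few_colors card_many_colors)
qed

end

theorem theorem1p6:
  fixes p r c :: nat
  assumes "prime p" and "p \<ge> 3" and "r \<ge> 3"
    and "c = (if even (ord p 2) then 1 else 2)"
  shows "real (g r p) =
           real (r choose 2) * 2 ^ p - real r ^ 2 + 2 * real r
           + real r * real ((r - 1) choose 2) * real p
             * (2 powr ((real p - 1) / (real c * real (ord p 2))) - 2)"
proof -
  interpret odd_prime p using assms by unfold_locales auto
  define m where "m = card cosets"
  have pm: "p - 1 = c * ord p 2 * m" using card_cosets assms by (simp add: m_def)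
  have "0 < m" using finite_cosets cosets_nonempty by (simp add: m_def card_gt_0_iff)
  \<comment> \<open>These bounds make the natural-number subtractions of 2 exact when passing to the
    reals.\<close>
  then have two_le: "(2::nat) \<le> 2 ^ m" "(2::nat) \<le> 2 ^ p"
    using power_increasing[of 1 m "2::nat"] power_increasing[of 1 p "2::nat"] p_gt_2 by auto
  obtain n where "ord p 2 = Suc n" using ord_2_pos gr0_implies_Suc by blast
  then have "real c * real (ord p 2) \<noteq> 0" using assms(4) by simp
  have "real p - 1 = real (p - 1)" using p_gt_2 by simp
  also have "\<dots> = real c * real (ord p 2) * real m" unfolding pm by simp
  finally have "(real p - 1) / (real c * real (ord p 2)) = real m"
    using \<open>real c * real (ord p 2) \<noteq> 0\<close> by simp
  then have exponent: "2 powr ((real p - 1) / (real c * real (ord p 2))) = 2 ^ m"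
    by (simp add: powr_realpow)
  \<comment> \<open>The polynomial part of the formula comes from
    \<open>r - 2 * (r choose 2) = 2 * r - r ^ 2\<close>.\<close>
  have "even (r * (r - 1))" by (cases r) auto
  then have "2 * (r choose 2) = r * (r - 1)" unfolding choose_two by (rule dvd_mult_div_cancel)
  then have "2 * real (r choose 2) = real r * real (r - 1)" by (metis of_nat_mult of_nat_numeral)
  also have "real (r - 1) = real r - 1" using assms by simp
  finally have "2 * real (r choose 2) = real r ^ 2 - real r" by (simp add: algebra_simps power2_eq_square)
  moreover have "real (g r p) = real r + real (r choose 2) * (2 ^ p - 2)
      + real r * real p * real ((r - 1) choose 2) * (2 ^ m - 2)"
    unfolding g_eq m_def[symmetric] using two_le by (simp add: of_nat_diff)
  ultimately show ?thesis unfolding exponent by (simp add: algebra_simps)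
qed

end
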